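(* Let $G=(V_G,E_G)$ be a $d_G$-regular graph and $H=(V_H,E_H)$ be a $d_H$-regular graph. Let $x_1,x_2\in V_G$ with $x_1\sim x_2$ and let $y\in V_H$. Then $$\kappa^{G\times H}_p((x_1,y),(x_2,y))=\begin{cases}\frac{d_G}{d_G+d_H}\kappa^G_p(x_1,x_2)+\frac{d_Gd_H}{d_G+d_H}\left(\kappa^G(x_1,x_2)-\kappa^G_0(x_1,x_2)\right)p, & \text{if } p\in\left[0,\frac{1}{d_G+d_H+1}\right],\\[4pt] \frac{d_G}{d_G+d_H}\kappa^G(x_1,x_2)(1-p), & \text{if } p\in\left[\frac{1}{d_G+d_H+1},1\right].\end{cases}$$
   Context: Graphs are locally finite with no multiple edges or self loops (and are undirected). $x\sim y$ means that $x$ and $y$ are joined by an edge; $d_x$ is the degree of $x$; $d(x,y)$ is the combinatorial (shortest path) distance, with $d(x,y)=\infty$ if there is no path. A graph is $d$-regular if all its vertices have degree $d$. $G\times H$ denotes the Cartesian product: its vertex set is $V_G\times V_H$, and $(u,v)\sim(u',v')$ if and only if either $u=u'$ and $v\sim v'$ in $H$, or $v=v'$ and $u\sim u'$ in $G$. For a graph with vertex set $V$, $x\in V$ with $d_x\ge 1$ and $p\in[0,1]$, $\mu_x^p$ is the probability measure on $V$ with $\mu_x^p(x)=p$, $\mu_x^p(z)=\frac{1-p}{d_x}$ for $z\sim x$, and $\mu_x^p(z)=0$ otherwise. For probability measures $\mu_1,\mu_2$ on $V$, $W_1(\mu_1,\mu_2)=\inf_{\pi}\sum_{u\in V}\sum_{v\in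 V}d(u,v)\pi(u,v)$, the infimum being over all $\pi:V\times V\to[0,1]$ with $\sum_{v}\pi(u,v)=\mu_1(u)$ for all $u$ and $\sum_{u}\pi(u,v)=\mu_2(v)$ for all $v$ (convention $\infty\cdot 0=0$). For an edge $x\sim y$, $\kappa_p(x,y)=1-W_1(\mu_x^p,\mu_y^p)$ and $\kappa(x,y)=\lim_{p\to1}\frac{\kappa_p(x,y)}{1-p}$. Superscripts $G$ and $G\times H$ indicate the graph in which these curvatures are computed. *)

theory Defs
  imports "HOL-Analysis.Infinite_Sum" "HOL-Library.Extended_Nonnegative_Real"
begin

record 'a sgraph =
  vertices :: "'a set"
  adj :: "'a \<Rightarrow> 'a \<Rightarrow> bool"

locale locally_finite_graph =
  fixes G :: "'a sgraph"
  assumes adj_vertices: "adj G x y \<Longrightarrow> x \<in> vertices G \<and> y \<in> vertices G"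
    and adj_sym: "adj G x y \<Longrightarrow> adj G y x"
    and adj_irrefl: "\<not> adj G x x"
    and locally_finite: "x \<in> vertices G \<Longrightarrow> finite {z. adj G x z}"

definition vertex_degree :: "'a sgraph \<Rightarrow> 'a \<Rightarrow> nat"
  where "vertex_degree G x = card {z. adj G x z}"

definition regular_graph :: "'a sgraph \<Rightarrow> nat \<Rightarrow> bool"
  where "regular_graph G d \<longleftrightarrow> (\<forall>x\<in>vertices G. vertex_degree G x = d)"

definition cartesian_product :: "'a sgraph \<Rightarrow> 'b sgraph \<Rightarrow> ('a \<times> 'b) sgraph"
  where "cartesian_product G H =
    \<lparr>vertices = vertices G \<times> vertices H,
     adj = (\<lambda>(u, v) (u', v').
       u = u' \<and> u \<in> vertices G \<and> adj H v v' \<or>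
       v = v' \<and> v \<in> vertices H \<and> adj G u u')\<rparr>"

(* The relational power adj G ^^ n relates the end points of walks with n edges;
   the infimum of the empty set is top = \<infinity>. *)
definition graph_dist :: "'a sgraph \<Rightarrow> 'a \<Rightarrow> 'a \<Rightarrow> enat"
  where "graph_dist G x y = (INF n\<in>{n. (adj G ^^ n) x y}. enat n)"

definition lazy_measure :: "'a sgraph \<Rightarrow> real \<Rightarrow> 'a \<Rightarrow> 'a \<Rightarrow> real"
  where "lazy_measure G p x z =
    (if z = x then p
     else if adj G x z then (1 - p) / real (vertex_degree G x)
     else 0)"

definition couplings :: "'a set \<Rightarrow> ('a \<Rightarrow> real) \<Rightarrow> ('a \<Rightarrow> real) \<Rightarrow> ('a \<times> 'a \<Rightarrow> real) set"
  where "couplings V \<mu> \<nu> =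
    {\<pi>. (\<forall>u\<in>V. \<forall>v\<in>V. \<pi> (u, v) \<in> {0..1}) \<and>
        (\<forall>u\<in>V. ((\<lambda>v. \<pi> (u, v)) has_sum \<mu> u) V) \<and>
        (\<forall>v\<in>V. ((\<lambda>u. \<pi> (u, v)) has_sum \<nu> v) V)}"

(* Valued in ennreal, where every sum converges and top * 0 = 0. *)
definition wasserstein :: "'a sgraph \<Rightarrow> ('a \<Rightarrow> real) \<Rightarrow> ('a \<Rightarrow> real) \<Rightarrow> ennreal"
  where "wasserstein G \<mu> \<nu> =
    (INF \<pi>\<in>couplings (vertices G) \<mu> \<nu>.
      \<Sum>\<^sub>\<infinity>u\<in>vertices G. \<Sum>\<^sub>\<infinity>v\<in>vertices G.
        ennreal_of_enat (graph_dist G u v) * ennreal (\<pi> (u, v)))"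

(* Only meant for edges x ~ y and p in [0,1]: the two measures then have finite supports whose
   points are at mutual distance at most 3, so the Wasserstein distance is finite and
   enn2real (which sends top to 0) loses nothing. *)
definition curvature_at :: "'a sgraph \<Rightarrow> real \<Rightarrow> 'a \<Rightarrow> 'a \<Rightarrow> real"
  where "curvature_at G p x y =
    1 - enn2real (wasserstein G (lazy_measure G p x) (lazy_measure G p y))"

(* Idleness ranges over [0,1], hence the one-sided limit. *)
definition curvature :: "'a sgraph \<Rightarrow> 'a \<Rightarrow> 'a \<Rightarrow> real"
  where "curvature G x y = Lim (at_left 1) (\<lambda>p. curvature_at G p x y / (1 - p))"

end

theory Submission
  imports Defs
begin

text \<open>Let \<open>x \<sim> y\<close> in a \<open>d\<close>-regular graph, and transport mass \<open>p\<close> at \<open>x\<close> and \<open>q\<close> at each neighbour of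
  \<open>x\<close> to the same configuration at \<open>y\<close>. Let \<open>m0\<close> be the minimal cost of a bijection between the two
  spheres and \<open>m1\<close> that of a bijection between the two closed balls. By Birkhoff's theorem the optimal
  cost is \<open>(q - p) m0 + p m1\<close> for \<open>p \<le> q\<close>; for \<open>p \<ge> q\<close> the excess \<open>p - q\<close> may be sent from \<open>x\<close> to \<open>y\<close>,
  so the cost is \<open>q m1 + (p - q)\<close>. In the product with a \<open>d'\<close>-regular graph, the \<open>d'\<close> additional
  neighbours \<open>(x, w)\<close> may be sent to \<open>(y, w)\<close>, which adds exactly \<open>d' q\<close>. With \<open>q = (1 - p) / d\<close> in the
  factor and \<open>q = (1 - p) / (d + d')\<close> in the product, both curvatures are explicit in \<open>m0\<close> and \<open>m1\<close>,
  and \<open>p = q\<close> is the threshold \<open>1 / (d + 1)\<close>, respectively \<open>1 / (d + d' + 1)\<close>.\<close>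

section \<open>Finite transport problems\<close>

text \<open>Induction on \<open>card A\<close>, split by whether some nonempty proper subset is
  tight, that is, has exactly as many neighbours as elements.\<close>

lemma hall:
  assumes "finite A" and "\<And>a. a \<in> A \<Longrightarrow> finite (N a)"
    and "\<And>X. X \<subseteq> A \<Longrightarrow> card X \<le> card (\<Union>a\<in>X. N a)"
  obtains f where "inj_on f A" and "\<And>a. a \<in> A \<Longrightarrow> f a \<in> N a"
proof -
  have "\<exists>f. inj_on f A \<and> (\<forall>a\<in>A. f a \<in> N a)"
    using assms
  proof (induction "card A" arbitrary: A N rule: less_induct)
    case less
    note fin = less.prems(1) and finN = less.prems(2) and hall = less.prems(3)
    show ?case
    proof (cases "A = {}")
      case True
      then show ?thesis by simp
    next
      case False
      then obtain a where a: "a \<in> A" by blast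
      have finU: "finite (\<Union>a\<in>X. N a)" if "X \<subseteq> A" for X
        using that finN fin finite_subset by blast
      show ?thesis
      proof (cases "\<exists>X. X \<subset> A \<and> X \<noteq> {} \<and> card (\<Union>a\<in>X. N a) = card X")
        case True
        then obtain X where X: "X \<subset> A" "X \<noteq> {}" "card (\<Union>a\<in>X. N a) = card X" by blast
        have finX: "finite X" using X fin finite_subset by blast
        have "card X < card A" using X fin by (simp add: psubset_card_mono)
        then obtain f where f: "inj_on f X" "\<forall>a\<in>X. f a \<in> N a"
          using less.hyps[of X N, OF _ finX] X(1) finN hall by (metis psubsetE subset_trans subsetD)
        let ?U = "\<Union>a\<in>X. N a"
        \<comment> \<open>Deleting the neighbours of the tight \<open>X\<close> preserves Hall's
          condition on \<open>A - X\<close>: the condition for \<open>Y \<union> X\<close> loses at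
          most \<open>card X\<close> on both sides.\<close>
        let ?M = "\<lambda>a. N a - ?U"
        have "card (A - X) < card A"
          using X fin by (intro psubset_card_mono) auto
        moreover have "card Y \<le> card (\<Union>a\<in>Y. ?M a)" if Y: "Y \<subseteq> A - X" for Y
        proof -
          have finY: "finite Y" using Y fin finite_subset by blast
          have "card Y + card X = card (Y \<union> X)"
            using Y finX finY by (subst card_Un_disjoint) auto
          also have "\<dots> \<le> card (\<Union>a\<in>Y \<union> X. N a)" using hall[of "Y \<union> X"] X Y by blast
          also have "(\<Union>a\<in>Y \<union> X. N a) = (\<Union>a\<in>Y. ?M a) \<union> ?U" by blast
          also have "card \<dots> \<le> card (\<Union>a\<in>Y. ?M a) + card ?U" by (rule card_Un_le)
          finally show ?thesis using X(3) by simp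
        qed
        ultimately obtain g where g: "inj_on g (A - X)" "\<forall>a\<in>A - X. g a \<in> ?M a"
          using less.hyps[of "A - X" ?M] fin finN by auto
        let ?h = "\<lambda>a. if a \<in> X then f a else g a"
        have "inj_on ?h A"
        proof (rule inj_onI)
          fix u v assume uv: "u \<in> A" "v \<in> A" "?h u = ?h v"
          consider "u \<in> X" "v \<in> X" | "u \<in> X" "v \<notin> X" | "u \<notin> X" "v \<in> X" | "u \<notin> X" "v \<notin> X"
            by blast
          then show "u = v"
          proof cases
            case 1
            then show ?thesis using uv f(1) by (simp add: inj_on_eq_iff)
          next
            case 2
            then have "f u \<in> ?U" "g v \<notin> ?U" using uv(1,2) f(2) g(2) by auto
            then show ?thesis using uv 2 by simp
          next
            case 3
            then have "f v \<in> ?U" "g u \<notin> ?U" using uv(1,2) f(2) g(2) by auto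
            then show ?thesis using uv 3 by simp
          next
            case 4
            then show ?thesis using uv g(1) by (simp add: inj_on_eq_iff)
          qed
        qed
        moreover have "\<forall>a\<in>A. ?h a \<in> N a" using f g by auto
        ultimately show ?thesis by blast
      next
        \<comment> \<open>Every nonempty proper subset now has a neighbour to spare, so
          \<open>a\<close> may take any of its neighbours.\<close>
        case notight: False
        have "card (\<Union>a\<in>{a}. N a) \<ge> 1" using hall[of "{a}"] a by simp
        then obtain b where b: "b \<in> N a" by fastforce
        let ?M = "\<lambda>a. N a - {b}"
        have "card (A - {a}) < card A" using a fin by (simp add: card_gt_0_iff False)
        moreover have "card Y \<le> card (\<Union>a\<in>Y. ?M a)" if Y: "Y \<subseteq> A - {a}" for Y
        proof (cases "Y = {}")
          case False
          have YA: "Y \<subset> A" using Y a by blast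
          then have "card Y \<noteq> card (\<Union>a\<in>Y. N a)" using notight False by metis
          then have "card Y < card (\<Union>a\<in>Y. N a)" using hall[of Y] YA by force
          moreover have "(\<Union>a\<in>Y. ?M a) = (\<Union>a\<in>Y. N a) - {b}" by blast
          moreover have "card (\<Union>a\<in>Y. N a) - 1 \<le> card ((\<Union>a\<in>Y. N a) - {b})"
            using finU[of Y] YA by (simp add: card_Diff_singleton_if)
          ultimately show ?thesis by simp
        qed simp
        ultimately obtain g where g: "inj_on g (A - {a})" "\<forall>a'\<in>A - {a}. g a' \<in> ?M a'"
          using less.hyps[of "A - {a}" ?M] fin finN by auto
        have "inj_on (g(a := b)) A"
          using g a unfolding inj_on_def by auto
        moreover have "\<forall>a'\<in>A. (g(a := b)) a' \<in> N a'" using g b by auto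
        ultimately show ?thesis by blast
      qed
    qed
  qed
  then show thesis using that by blast
qed

section \<open>Transport plans and optimal costs\<close>

text \<open>Marginals of any total mass are allowed, so plans can be added, scaled and stripped of
  part of their mass.\<close>

definition transport_plan ::
    "'a set \<Rightarrow> 'b set \<Rightarrow> ('a \<Rightarrow> real) \<Rightarrow> ('b \<Rightarrow> real) \<Rightarrow> ('a \<Rightarrow> 'b \<Rightarrow> real) \<Rightarrow> bool"
  where "transport_plan A B \<mu> \<nu> P \<longleftrightarrow>
    (\<forall>a\<in>A. \<forall>b\<in>B. 0 \<le> P a b) \<and> (\<forall>a\<in>A. (\<Sum>b\<in>B. P a b) = \<mu> a) \<and> (\<forall>b\<in>B. (\<Sum>a\<in>A. P a b) = \<nu> b)"

definition transport_cost ::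
    "('a \<Rightarrow> 'b \<Rightarrow> real) \<Rightarrow> 'a set \<Rightarrow> 'b set \<Rightarrow> ('a \<Rightarrow> 'b \<Rightarrow> real) \<Rightarrow> real"
  where "transport_cost c A B P = (\<Sum>a\<in>A. \<Sum>b\<in>B. c a b * P a b)"

text \<open>A relation instead of an infimum: it records that the minimum is attained.\<close>

definition optimal_cost ::
    "('a \<Rightarrow> 'b \<Rightarrow> real) \<Rightarrow> 'a set \<Rightarrow> 'b set \<Rightarrow> ('a \<Rightarrow> real) \<Rightarrow> ('b \<Rightarrow> real) \<Rightarrow> real \<Rightarrow> bool"
  where "optimal_cost c A B \<mu> \<nu> w \<longleftrightarrow>
    (\<exists>P. transport_plan A B \<mu> \<nu> P \<and> transport_cost c A B P = w) \<and>
    (\<forall>P. transport_plan A B \<mu> \<nu> P \<longrightarrow> w \<le> transport_cost c A B P)"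

lemma transport_plan_add:
  assumes "transport_plan A B \<mu> \<nu> P" and "transport_plan A B \<mu>' \<nu>' Q"
  shows "transport_plan A B (\<lambda>a. \<mu> a + \<mu>' a) (\<lambda>b. \<nu> b + \<nu>' b) (\<lambda>a b. P a b + Q a b)"
  using assms by (simp add: transport_plan_def sum.distrib)

lemma transport_plan_scale:
  assumes "transport_plan A B \<mu> \<nu> P" and "0 \<le> t"
  shows "transport_plan A B (\<lambda>a. t * \<mu> a) (\<lambda>b. t * \<nu> b) (\<lambda>a b. t * P a b)"
  using assms by (simp add: transport_plan_def flip: sum_distrib_left)

lemma transport_plan_cong:
  assumes "transport_plan A B \<mu> \<nu> P"
    and "\<And>a. a \<in> A \<Longrightarrow> \<mu> a = \<mu>' a" and "\<And>b. b \<in> B \<Longrightarrow> \<nu> b = \<nu>' b"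
  shows "transport_plan A B \<mu>' \<nu>' P"
  using assms by (simp add: transport_plan_def)

lemma transport_cost_add:
  "transport_cost c A B (\<lambda>a b. P a b + Q a b) = transport_cost c A B P + transport_cost c A B Q"
  by (simp add: transport_cost_def distrib_left sum.distrib)

lemma transport_cost_scale:
  "transport_cost c A B (\<lambda>a b. t * P a b) = t * transport_cost c A B P"
  by (simp add: transport_cost_def sum_distrib_left mult.left_commute)

lemma optimal_cost_cong:
  assumes "optimal_cost c A B \<mu> \<nu> w"
    and "\<And>a b. \<lbrakk>a \<in> A; b \<in> B\<rbrakk> \<Longrightarrow> c a b = c' a b"
    and "\<And>a. a \<in> A \<Longrightarrow> \<mu> a = \<mu>' a" and "\<And>b. b \<in> B \<Longrightarrow> \<nu> b = \<nu>' b" and "w = w'"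
  shows "optimal_cost c' A B \<mu>' \<nu>' w'"
proof -
  have "transport_plan A B \<mu> \<nu> P = transport_plan A B \<mu>' \<nu>' P" for P
    using assms(3,4) by (simp add: transport_plan_def)
  moreover have "transport_cost c A B P = transport_cost c' A B P" for P
    unfolding transport_cost_def using assms(2) by (intro sum.cong) auto
  ultimately show ?thesis using assms(1,5) by (simp add: optimal_cost_def)
qed

text \<open>Partial permutation matrices. With subsets \<open>S\<close> and \<open>T\<close>,
  matchings of spheres, of balls, of the two centres and of the common vertices become plans on the
  same index sets and can be combined.\<close>

lemma transport_plan_matching:
  assumes "finite A" "finite B" "S \<subseteq> A" "T \<subseteq> B" and \<sigma>: "bij_betw \<sigma> S T"
  shows "transport_plan A B (\<lambda>a. of_bool (a \<in> S)) (\<lambda>b. of_bool (b \<in> T))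
           (\<lambda>a b. of_bool (a \<in> S \<and> b = \<sigma> a))"
proof -
  have row: "(\<Sum>b\<in>B. of_bool (a \<in> S \<and> b = \<sigma> a)) = (of_bool (a \<in> S) :: real)" if "a \<in> A" for a
  proof -
    have "a \<in> S \<Longrightarrow> \<sigma> a \<in> B" using \<sigma> assms(4) bij_betwE by blast
    then show ?thesis using \<open>finite B\<close> by (auto simp: of_bool_def)
  qed
  have col: "(\<Sum>a\<in>A. of_bool (a \<in> S \<and> b = \<sigma> a)) = (of_bool (b \<in> T) :: real)" if "b \<in> B" for b
  proof (cases "b \<in> T")
    case True
    then obtain a where a: "a \<in> S" "b = \<sigma> a" using \<sigma> by (metis bij_betw_imp_surj_on imageE)
    then have "(a' \<in> S \<and> b = \<sigma> a') = (a' = a)" for a'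
      using \<sigma> by (metis bij_betw_imp_inj_on inj_onD)
    then show ?thesis using True a assms(1,3) by (auto simp: of_bool_def)
  next
    case False
    then have "\<not> (a \<in> S \<and> b = \<sigma> a)" for a using \<sigma> bij_betwE by metis
    then have "(\<Sum>a\<in>A. of_bool (a \<in> S \<and> b = \<sigma> a)) = (\<Sum>a\<in>A. 0 :: real)"
      by (intro sum.cong) simp_all
    then show ?thesis using False by simp
  qed
  show ?thesis using row col by (simp add: transport_plan_def)
qed

lemma transport_cost_matching:
  assumes "finite A" "finite B" "S \<subseteq> A" "T \<subseteq> B" and \<sigma>: "bij_betw \<sigma> S T"
  shows "transport_cost c A B (\<lambda>a b. of_bool (a \<in> S \<and> b = \<sigma> a)) = (\<Sum>a\<in>S. c a (\<sigma> a))"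
proof -
  have "(\<Sum>b\<in>B. c a b * of_bool (a \<in> S \<and> b = \<sigma> a)) = (if a \<in> S then c a (\<sigma> a) else 0)" for a
  proof -
    have "a \<in> S \<Longrightarrow> \<sigma> a \<in> B" using \<sigma> assms(4) bij_betwE by blast
    moreover have "c a b * of_bool (a \<in> S \<and> b = \<sigma> a) = (if b = \<sigma> a then c a b * of_bool (a \<in> S) else 0)" for b
      by simp
    ultimately show ?thesis using \<open>finite B\<close> by (simp add: sum.delta')
  qed
  then show ?thesis
    using assms(1,3) by (simp add: transport_cost_def sum.If_cases Int_absorb1)
qed

section \<open>Birkhoff's theorem and minimal matchings\<close>

text \<open>Hall's condition comes from counting mass: the rows in \<open>X\<close> carry
  \<open>t * card X\<close>, all of it in the columns that \<open>X\<close> reaches, and each column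
  holds only \<open>t\<close>.\<close>

lemma transport_plan_support_matching:
  assumes "finite A" "finite B" "card A = card B"
    and P: "transport_plan A B (\<lambda>_. t) (\<lambda>_. t) P" and "0 < t"
  obtains \<sigma> where "bij_betw \<sigma> A B" and "\<And>a. a \<in> A \<Longrightarrow> 0 < P a (\<sigma> a)"
proof -
  define N where "N a = {b\<in>B. 0 < P a b}" for a
  have "card X \<le> card (\<Union>a\<in>X. N a)" if X: "X \<subseteq> A" for X
  proof -
    let ?U = "\<Union>a\<in>X. N a"
    have U: "?U \<subseteq> B" by (auto simp: N_def)
    have finX: "finite X" and finU: "finite ?U"
      using X U assms(1,2) finite_subset by blast+
    have "t * card X = (\<Sum>a\<in>X. \<Sum>b\<in>B. P a b)"
      using P X by (simp add: transport_plan_def subset_iff)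
    also have "\<dots> = (\<Sum>a\<in>X. \<Sum>b\<in>?U. P a b)"
    proof (rule sum.cong[OF refl])
      fix a assume "a \<in> X"
      then show "(\<Sum>b\<in>B. P a b) = (\<Sum>b\<in>?U. P a b)"
        using X U P \<open>finite B\<close>
        by (intro sum.mono_neutral_right) (force simp: N_def transport_plan_def)+
    qed
    also have "\<dots> = (\<Sum>b\<in>?U. \<Sum>a\<in>X. P a b)" by (rule sum.swap)
    also have "\<dots> \<le> (\<Sum>b\<in>?U. \<Sum>a\<in>A. P a b)"
      using X U P \<open>finite A\<close>
      by (intro sum_mono sum_mono2) (auto simp: transport_plan_def subset_iff)
    also have "\<dots> = (\<Sum>b\<in>?U. t)"
      using U P by (intro sum.cong) (auto simp: transport_plan_def)
    finally show ?thesis using \<open>0 < t\<close> by (simp add: mult.commute)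
  qed
  then obtain \<sigma> where \<sigma>: "inj_on \<sigma> A" "\<And>a. a \<in> A \<Longrightarrow> \<sigma> a \<in> N a"
    using hall[of A N] assms(1,2) by (auto simp: N_def)
  then have "\<sigma> ` A \<subseteq> B" by (auto simp: N_def)
  then have "bij_betw \<sigma> A B"
    using \<sigma>(1) assms(2,3) by (simp add: bij_betw_def card_image card_subset_eq)
  then show thesis using \<sigma>(2) that by (auto simp: N_def)
qed

text \<open>The dual form of Birkhoff's theorem: a linear functional is bounded on all doubly
  stochastic matrices by its values at the permutation matrices.\<close>

lemma transport_cost_ge_matchings:
  assumes "finite A" "finite B" "card A = card B"
    and "transport_plan A B (\<lambda>_. t) (\<lambda>_. t) P" and "0 \<le> t"
    and m: "\<And>\<sigma>. bij_betw \<sigma> A B \<Longrightarrow> m \<le> (\<Sum>a\<in>A. c a (\<sigma> a))"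
  shows "t * m \<le> transport_cost c A B P"
  using assms(4,5)
\<comment> \<open>Induction on the number of positive entries: subtracting a multiple of a
  permutation matrix makes one of them vanish.\<close>
proof (induction "card {(a, b)\<in>A \<times> B. 0 < P a b}" arbitrary: P t rule: less_induct)
  case less
  note P = less.prems(1)
  show ?case
  proof (cases "t = 0 \<or> A = {}")
    case True
    then have "P a b = 0" if "a \<in> A" "b \<in> B" for a b
    proof -
      have "(\<Sum>b\<in>B. P a b) = 0" "\<forall>b\<in>B. 0 \<le> P a b"
        using that P True by (auto simp: transport_plan_def)
      then show ?thesis using that \<open>finite B\<close> by (simp add: sum_nonneg_eq_0_iff)
    qed
    then have "transport_cost c A B P = 0" by (simp add: transport_cost_def)
    moreover have "m \<le> 0 \<or> t = 0"
    proof (cases "t = 0")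
      case False
      then have "A = {}" "B = {}" using True assms(2,3) by auto
      \<comment> \<open>Between empty sets any function is a bijection, and its empty cost sum
        forces \<open>m \<le> 0\<close>.\<close>
      then show ?thesis using m[of "\<lambda>_. undefined"] by (simp add: bij_betw_def)
    qed simp
    ultimately show ?thesis using less.prems(2) by (auto simp: mult_nonneg_nonpos)
  next
    case False
    then have "0 < t" using less.prems(2) by simp
    then obtain \<sigma> where \<sigma>: "bij_betw \<sigma> A B" and pos: "\<And>a. a \<in> A \<Longrightarrow> 0 < P a (\<sigma> a)"
      using transport_plan_support_matching[OF assms(1-3) P] by blast
    \<comment> \<open>The smallest entry along \<open>\<sigma>\<close> is the largest multiple that
      can be subtracted without creating a negative entry.\<close>
    define e where "e = Min ((\<lambda>a. P a (\<sigma> a)) ` A)"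
    have "e \<in> (\<lambda>a. P a (\<sigma> a)) ` A" unfolding e_def using False assms(1) by (intro Min_in) auto
    then obtain a0 where a0: "a0 \<in> A" "e = P a0 (\<sigma> a0)" by blast
    have le: "e \<le> P a (\<sigma> a)" if "a \<in> A" for a
      unfolding e_def using assms(1) that by simp
    have e: "0 < e" using a0 pos by simp
    define M where "M = (\<lambda>a b. of_bool (a \<in> A \<and> b = \<sigma> a) :: real)"
    define Q where "Q = (\<lambda>a b. P a b + (- e) * M a b)"
    have MP: "transport_plan A B (\<lambda>_. 1) (\<lambda>_. 1) M"
      using transport_plan_matching[OF assms(1,2) subset_refl subset_refl \<sigma>]
      unfolding M_def by (rule transport_plan_cong) auto
    have sb: "\<sigma> a \<in> B" if "a \<in> A" for a using \<sigma> that bij_betwE by metis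
    have Q: "transport_plan A B (\<lambda>_. t - e) (\<lambda>_. t - e) Q"
      unfolding transport_plan_def
    proof (intro conjI ballI)
      show "0 \<le> Q a b" if "a \<in> A" "b \<in> B" for a b
        using P le that by (auto simp: Q_def M_def transport_plan_def)
      show "(\<Sum>b\<in>B. Q a b) = t - e" if "a \<in> A" for a
        using P MP that unfolding Q_def sum.distrib sum_distrib_left[symmetric] transport_plan_def
        by simp
      show "(\<Sum>a\<in>A. Q a b) = t - e" if "b \<in> B" for b
        using P MP that unfolding Q_def sum.distrib sum_distrib_left[symmetric] transport_plan_def
        by simp
    qed
    have "e \<le> t"
    proof -
      have "P a0 (\<sigma> a0) \<le> (\<Sum>b\<in>B. P a0 b)"
        using P a0 sb assms(2) by (intro member_le_sum) (auto simp: transport_plan_def)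
      then show ?thesis using P a0 by (simp add: transport_plan_def)
    qed
    have "{(a, b)\<in>A \<times> B. 0 < Q a b} \<subset> {(a, b)\<in>A \<times> B. 0 < P a b}"
    proof
      show "{(a, b)\<in>A \<times> B. 0 < Q a b} \<subseteq> {(a, b)\<in>A \<times> B. 0 < P a b}"
        using e pos by (auto simp: Q_def M_def split: if_splits)
      have "(a0, \<sigma> a0) \<in> {(a, b)\<in>A \<times> B. 0 < P a b} - {(a, b)\<in>A \<times> B. 0 < Q a b}"
        using a0 pos sb by (auto simp: Q_def M_def)
      then show "{(a, b)\<in>A \<times> B. 0 < Q a b} \<noteq> {(a, b)\<in>A \<times> B. 0 < P a b}" by blast
    qed
    moreover have "finite {(a, b)\<in>A \<times> B. 0 < P a b}"
      by (rule finite_subset[of _ "A \<times> B"]) (auto simp: assms)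
    ultimately have "card {(a, b)\<in>A \<times> B. 0 < Q a b} < card {(a, b)\<in>A \<times> B. 0 < P a b}"
      by (rule psubset_card_mono[rotated])
    then have "(t - e) * m \<le> transport_cost c A B Q"
      using less.hyps Q \<open>e \<le> t\<close> by simp
    moreover have "transport_cost c A B Q = transport_cost c A B P - e * (\<Sum>a\<in>A. c a (\<sigma> a))"
      unfolding Q_def transport_cost_add transport_cost_scale
      using transport_cost_matching[OF assms(1,2) subset_refl subset_refl \<sigma>, of c]
      by (simp add: M_def)
    moreover have "e * m \<le> e * (\<Sum>a\<in>A. c a (\<sigma> a))" using m[OF \<sigma>] e by simp
    ultimately show ?thesis by (simp add: algebra_simps)
  qed
qed

text \<open>The cost depends on the values on \<open>A\<close> alone, so it suffices to minimise
  over the finitely many bijections in \<open>A \<rightarrow>\<^sub>E B\<close>.\<close>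

lemma minimal_matching:
  assumes "finite A" "finite B" "card A = card B"
  obtains \<sigma> where "bij_betw \<sigma> A B"
    and "\<And>\<tau>. bij_betw \<tau> A B \<Longrightarrow> (\<Sum>a\<in>A. c a (\<sigma> a)) \<le> (\<Sum>a\<in>A. c a (\<tau> a) :: real)"
proof -
  let ?F = "{\<sigma>. bij_betw \<sigma> A B} \<inter> (A \<rightarrow>\<^sub>E B)"
  have fin: "finite ?F" using assms by (simp add: finite_PiE)
  have restr: "restrict \<tau> A \<in> ?F" if "bij_betw \<tau> A B" for \<tau>
  proof -
    have "bij_betw (restrict \<tau> A) A B" using that by (simp cong: bij_betw_cong)
    then show ?thesis using bij_betwE[OF that] by auto
  qed
  have "?F \<noteq> {}" using finite_same_card_bij[OF assms] restr by blast
  then obtain \<sigma> where \<sigma>: "\<sigma> \<in> ?F" "\<forall>\<tau>\<in>?F. \<not> (\<Sum>a\<in>A. c a (\<tau> a)) < (\<Sum>a\<in>A. c a (\<sigma> a))"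
    using ex_min_if_finite[of "(\<lambda>\<sigma>. \<Sum>a\<in>A. c a (\<sigma> a)) ` ?F"] fin by auto
  have "(\<Sum>a\<in>A. c a (\<sigma> a)) \<le> (\<Sum>a\<in>A. c a (\<tau> a))" if "bij_betw \<tau> A B" for \<tau>
  proof -
    have "(\<Sum>a\<in>A. c a (restrict \<tau> A a)) = (\<Sum>a\<in>A. c a (\<tau> a))" by simp
    then show ?thesis using bspec[OF \<sigma>(2) restr[OF that]] by linarith
  qed
  then show thesis using \<sigma>(1) that by blast
qed

section \<open>Cancelling and rerouting mass\<close>

lemma transport_cost_split:
  assumes "finite A" "finite B" "x \<in> A" "z \<in> B"
  shows "transport_cost c A B P =
    c x z * P x z + (\<Sum>b\<in>B - {z}. c x b * P x b) + (\<Sum>a\<in>A - {x}. c a z * P a z)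
    + (\<Sum>a\<in>A - {x}. \<Sum>b\<in>B - {z}. c a b * P a b)"
  using assms by (simp add: transport_cost_def sum.remove[of A x] sum.remove[of B z] sum.distrib)

text \<open>Flows from \<open>x\<close> and flows into \<open>z\<close> are joined to flows bypassing both points; with
  \<open>x = z\<close> and \<open>K = 0\<close> the condition on \<open>c\<close> is the triangle inequality, and the lemma cancels
  mass common to both measures.\<close>

lemma transport_plan_glue:
  assumes fin: "finite A" "finite B" and x: "x \<in> A" and z: "z \<in> B"
    and P: "transport_plan A B \<mu> \<nu> P"
    and t: "0 \<le> t" "t \<le> \<mu> x" "t \<le> \<nu> z" and K: "K \<le> c x z"
    and quad: "\<And>a b. \<lbrakk>a \<in> A; b \<in> B; a \<noteq> x; b \<noteq> z; 0 < \<mu> a; 0 < \<nu> b\<rbrakk> \<Longrightarrow> c a b + K \<le> c a z + c x b"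
  obtains Q where "transport_plan A B (\<mu>(x := \<mu> x - t)) (\<nu>(z := \<nu> z - t)) Q"
    and "transport_cost c A B Q \<le> transport_cost c A B P - t * K"
proof -
  define m where "m = P x z"
  define A' where "A' = A - {x}"
  define B' where "B' = B - {z}"
  have fin': "finite A'" "finite B'" using fin by (auto simp: A'_def B'_def)
  have sumA: "sum h A = h x + sum h A'" for h :: "'a \<Rightarrow> real"
    using fin x by (simp add: A'_def sum.remove)
  have sumB: "sum h B = h z + sum h B'" for h :: "'b \<Rightarrow> real"
    using fin z by (simp add: B'_def sum.remove)
  have P0: "0 \<le> P a b" if "a \<in> A" "b \<in> B" for a b
    using P that by (simp add: transport_plan_def)
  have row: "P a z + (\<Sum>b\<in>B'. P a b) = \<mu> a" if "a \<in> A" for a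
    using P that sumB[of "P a"] by (simp add: transport_plan_def)
  have col: "P x b + (\<Sum>a\<in>A'. P a b) = \<nu> b" if "b \<in> B" for b
    using P that sumA[of "\<lambda>a. P a b"] by (simp add: transport_plan_def)
  have split: "transport_cost c A B R = c x z * R x z + (\<Sum>b\<in>B'. c x b * R x b)
      + (\<Sum>a\<in>A'. c a z * R a z) + (\<Sum>a\<in>A'. \<Sum>b\<in>B'. c a b * R a b)" for R
    unfolding A'_def B'_def by (rule transport_cost_split[OF fin x z])
  have A'D: "a \<in> A" "a \<noteq> x" if "a \<in> A'" for a using that by (auto simp: A'_def)
  have B'D: "b \<in> B" "b \<noteq> z" if "b \<in> B'" for b using that by (auto simp: B'_def)
  have planI: "transport_plan A B \<mu>' \<nu>' R"
    if "\<And>a b. a \<in> A \<Longrightarrow> b \<in> B \<Longrightarrow> 0 \<le> R a b"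
      and "R x z + (\<Sum>b\<in>B'. R x b) = \<mu>' x" "\<And>a. a \<in> A' \<Longrightarrow> R a z + (\<Sum>b\<in>B'. R a b) = \<mu>' a"
      and "R x z + (\<Sum>a\<in>A'. R a z) = \<nu>' z" "\<And>b. b \<in> B' \<Longrightarrow> R x b + (\<Sum>a\<in>A'. R a b) = \<nu>' b"
    for R \<mu>' \<nu>'
  proof -
    have "(\<Sum>b\<in>B. R a b) = \<mu>' a" if "a \<in> A" for a
      using that \<open>R x z + (\<Sum>b\<in>B'. R x b) = \<mu>' x\<close> \<open>\<And>a. a \<in> A' \<Longrightarrow> R a z + (\<Sum>b\<in>B'. R a b) = \<mu>' a\<close>
      by (cases "a = x") (auto simp: sumB A'_def)
    moreover have "(\<Sum>a\<in>A. R a b) = \<nu>' b" if "b \<in> B" for b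
      using that \<open>R x z + (\<Sum>a\<in>A'. R a z) = \<nu>' z\<close> \<open>\<And>b. b \<in> B' \<Longrightarrow> R x b + (\<Sum>a\<in>A'. R a b) = \<nu>' b\<close>
      by (cases "b = z") (auto simp: sumA B'_def)
    ultimately show ?thesis using that(1) by (simp add: transport_plan_def)
  qed
  show thesis
  proof (cases "t \<le> m")
    \<comment> \<open>The direct flow \<open>m\<close> from \<open>x\<close> to \<open>z\<close>
      suffices and is lowered by \<open>t\<close>.\<close>
    case True
    define Q where "Q = (\<lambda>a b. if a = x \<and> b = z then m - t else P a b)"
    have Qx: "(\<Sum>b\<in>B'. Q x b) = (\<Sum>b\<in>B'. P x b)" by (rule sum.cong) (auto simp: Q_def B'_def)
    have Qz: "(\<Sum>a\<in>A'. Q a z) = (\<Sum>a\<in>A'. P a z)" by (rule sum.cong) (auto simp: Q_def A'_def)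
    have Qa: "Q a b = P a b" if "a \<in> A' \<or> b \<in> B'" for a b
      using that by (auto simp: Q_def A'_def B'_def)
    have "transport_plan A B (\<mu>(x := \<mu> x - t)) (\<nu>(z := \<nu> z - t)) Q"
    proof (rule planI)
      show "0 \<le> Q a b" if "a \<in> A" "b \<in> B" for a b using that P0 True by (simp add: Q_def)
    qed (use row[OF x] col[OF z] row col A'D B'D Qx Qz in \<open>simp_all add: Qa Q_def m_def\<close>)
    moreover have "transport_cost c A B Q = transport_cost c A B P - t * c x z"
      unfolding split by (simp add: Qa) (simp add: Q_def m_def algebra_simps)
    moreover have "t * K \<le> t * c x z" using K t(1) by (rule mult_left_mono)
    ultimately show thesis using that by simp
  next
    case False
    \<comment> \<open>\<open>k\<close> is what the direct flow lacks; \<open>R\<close> and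
      \<open>C\<close> are the other flows out of \<open>x\<close> and into
      \<open>z\<close>.\<close>
    define k where "k = t - m"
    define R where "R = (\<Sum>b\<in>B'. P x b)"
    define C where "C = (\<Sum>a\<in>A'. P a z)"
    have k: "0 < k" using False by (simp add: k_def)
    have R: "R = \<mu> x - m" using row[OF x] by (simp add: R_def m_def)
    have C: "C = \<nu> z - m" using col[OF z] by (simp add: C_def m_def)
    have kR: "k \<le> R" and kC: "k \<le> C" using t R C by (auto simp: k_def)
    have pos: "0 < R" "0 < C" using k kR kC by auto
    \<comment> \<open>The direct flow is dropped, \<open>k\<close> is withdrawn proportionally from
      the other flows out of \<open>x\<close> and into \<open>z\<close>, and the loose ends
      \<open>a\<close> and \<open>b\<close> are joined by a product plan of mass
      \<open>k\<close>.\<close>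
    define Q where "Q = (\<lambda>a b. if a = x then if b = z then 0 else (1 - k / R) * P x b
      else if b = z then (1 - k / C) * P a z else P a b + k / (R * C) * (P a z * P x b))"
    have Qxz: "Q x z = 0" by (simp add: Q_def)
    have Qx: "Q x b = (1 - k / R) * P x b" if "b \<in> B'" for b using that by (simp add: Q_def B'_def)
    have Qz: "Q a z = (1 - k / C) * P a z" if "a \<in> A'" for a using that by (simp add: Q_def A'_def)
    have Qa: "Q a b = P a b + k / (R * C) * (P a z * P x b)" if "a \<in> A'" "b \<in> B'" for a b
      using that by (simp add: Q_def A'_def B'_def)
    have "transport_plan A B (\<mu>(x := \<mu> x - t)) (\<nu>(z := \<nu> z - t)) Q"
    proof (rule planI)
      show "0 \<le> Q a b" if "a \<in> A" "b \<in> B" for a b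
        using that P0 x z k kR kC pos by (simp add: Q_def)
      have "(1 - k / R) * R = R - k" "(1 - k / C) * C = C - k"
        using pos by (simp_all add: left_diff_distrib)
      have "(\<Sum>b\<in>B'. Q x b) = (1 - k / R) * R"
        unfolding R_def sum_distrib_left using Qx by (simp add: R_def)
      then show "Q x z + (\<Sum>b\<in>B'. Q x b) = (\<mu>(x := \<mu> x - t)) x"
        using R Qxz \<open>(1 - k / R) * R = R - k\<close> by (simp add: k_def)
      have "(\<Sum>a\<in>A'. Q a z) = (1 - k / C) * C"
        unfolding C_def sum_distrib_left using Qz by (simp add: C_def)
      then show "Q x z + (\<Sum>a\<in>A'. Q a z) = (\<nu>(z := \<nu> z - t)) z"
        using C Qxz \<open>(1 - k / C) * C = C - k\<close> by (simp add: k_def)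
      fix a assume a: "a \<in> A'"
      have "(\<Sum>b\<in>B'. Q a b) = (\<Sum>b\<in>B'. P a b) + k / (R * C) * (P a z * R)"
        unfolding R_def[symmetric] sum_distrib_left[symmetric] using a
        by (simp add: Qa sum.distrib R_def sum_distrib_left)
      then show "Q a z + (\<Sum>b\<in>B'. Q a b) = (\<mu>(x := \<mu> x - t)) a"
        using pos row[of a] A'D[OF a] Qz[OF a] by (simp add: algebra_simps)
    next
      fix b assume b: "b \<in> B'"
      have "(\<Sum>a\<in>A'. Q a b) = (\<Sum>a\<in>A'. P a b) + k / (R * C) * (C * P x b)"
        using b by (simp add: Qa sum.distrib C_def sum_distrib_left sum_distrib_right)
      then show "Q x b + (\<Sum>a\<in>A'. Q a b) = (\<nu>(z := \<nu> z - t)) b"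
        using pos col[of b] B'D[OF b] Qx[OF b] by (simp add: algebra_simps)
    qed
    moreover have "transport_cost c A B Q \<le> transport_cost c A B P - t * K"
    proof -
      define X where "X = (\<Sum>b\<in>B'. c x b * P x b)"
      define Y where "Y = (\<Sum>a\<in>A'. c a z * P a z)"
      define S where "S = (\<Sum>a\<in>A'. \<Sum>b\<in>B'. c a b * (P a z * P x b))"
      \<comment> \<open>The condition \<open>quad\<close> is averaged with the weights
        \<open>P a z * P x b\<close>. Where such a weight is positive, both marginals are positive,
        as \<open>quad\<close> requires.\<close>
      have "S + K * (C * R) = (\<Sum>a\<in>A'. \<Sum>b\<in>B'. (c a b + K) * (P a z * P x b))"
        unfolding C_def R_def sum_product
        by (simp add: S_def distrib_right sum.distrib sum_distrib_left)
      also have "\<dots> \<le> (\<Sum>a\<in>A'. \<Sum>b\<in>B'. (c a z + c x b) * (P a z * P x b))"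
      proof (intro sum_mono)
        fix a b assume a: "a \<in> A'" and b: "b \<in> B'"
        show "(c a b + K) * (P a z * P x b) \<le> (c a z + c x b) * (P a z * P x b)"
        proof (cases "P a z = 0 \<or> P x b = 0")
          case False
          then have p: "0 < P a z" "0 < P x b"
            using P0 a b x z A'D B'D by (metis order_le_less)+
          have "0 \<le> (\<Sum>b\<in>B'. P a b)" "0 \<le> (\<Sum>a\<in>A'. P a b)"
            using P0 a b A'D B'D by (auto intro!: sum_nonneg)
          then have "0 < \<mu> a" "0 < \<nu> b" using p row col a b A'D B'D by (metis add_pos_nonneg)+
          then show ?thesis using quad a b A'D B'D p by (intro mult_right_mono) auto
        qed auto
      qed
      also have "\<dots> = Y * R + C * X"
        unfolding X_def Y_def C_def R_def sum_product
        by (simp add: sum.distrib[symmetric] algebra_simps)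
      finally have "k / (R * C) * (S + K * (C * R)) \<le> k / (R * C) * (Y * R + C * X)"
        using k pos by (intro mult_left_mono) auto
      then have *: "k / (R * C) * S + k * K \<le> k / C * Y + k / R * X"
        using pos by (simp add: field_simps)
      have "(\<Sum>b\<in>B'. c x b * Q x b) = (1 - k / R) * X"
        unfolding X_def sum_distrib_left by (rule sum.cong) (auto simp: Qx)
      moreover have "(\<Sum>a\<in>A'. c a z * Q a z) = (1 - k / C) * Y"
        unfolding Y_def sum_distrib_left by (rule sum.cong) (auto simp: Qz)
      moreover have "(\<Sum>a\<in>A'. \<Sum>b\<in>B'. c a b * Q a b)
          = (\<Sum>a\<in>A'. \<Sum>b\<in>B'. c a b * P a b) + k / (R * C) * S"
        unfolding S_def sum_distrib_left sum.distrib[symmetric]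
        by (intro sum.cong refl) (simp add: Qa algebra_simps)
      ultimately have "transport_cost c A B Q = transport_cost c A B P
          - c x z * m - k / R * X - k / C * Y + k / (R * C) * S"
        unfolding split X_def[symmetric] Y_def[symmetric] by (simp add: Qxz m_def algebra_simps)
      moreover have "m * K \<le> c x z * m"
        using mult_right_mono[OF K P0[OF x z]] by (simp add: m_def mult.commute)
      moreover have "t * K = m * K + k * K" by (simp add: k_def algebra_simps)
      ultimately show ?thesis using * by linarith
    qed
    ultimately show thesis using that by blast
  qed
qed

text \<open>The gluing lemma is iterated over the pairs \<open>(f i, g i)\<close>; injectivity keeps
  the marginals at the remaining pairs untouched. It serves with \<open>K = 0\<close> to cancel
  common mass and with \<open>K = 1\<close> for parallel copies of an edge.\<close>

lemma transport_plan_glue_set: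
  assumes fin: "finite A" "finite B" and "finite Z" "inj_on f Z" "inj_on g Z" "f ` Z \<subseteq> A" "g ` Z \<subseteq> B"
    and P: "transport_plan A B \<mu> \<nu> P" and t: "0 \<le> t"
    and "\<And>i. i \<in> Z \<Longrightarrow> t \<le> \<mu> (f i)" "\<And>i. i \<in> Z \<Longrightarrow> t \<le> \<nu> (g i)"
    and "\<And>i. i \<in> Z \<Longrightarrow> K \<le> c (f i) (g i)"
    and "\<And>i a b. \<lbrakk>i \<in> Z; a \<in> A; b \<in> B; a \<noteq> f i; b \<noteq> g i\<rbrakk> \<Longrightarrow> c a b + K \<le> c a (g i) + c (f i) b"
  obtains Q where
    "transport_plan A B (\<lambda>a. \<mu> a - t * of_bool (a \<in> f ` Z)) (\<lambda>b. \<nu> b - t * of_bool (b \<in> g ` Z)) Q"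
    and "transport_cost c A B Q \<le> transport_cost c A B P - real (card Z) * t * K"
proof -
  have "\<exists>Q. transport_plan A B (\<lambda>a. \<mu> a - t * of_bool (a \<in> f ` Z)) (\<lambda>b. \<nu> b - t * of_bool (b \<in> g ` Z)) Q
    \<and> transport_cost c A B Q \<le> transport_cost c A B P - real (card Z) * t * K"
    using assms(3-7,10-)
  proof (induction Z rule: finite_induct)
    case empty
    then show ?case using P by auto
  next
    case (insert i Z)
    let ?\<mu> = "\<lambda>a. \<mu> a - t * of_bool (a \<in> f ` Z)" and ?\<nu> = "\<lambda>b. \<nu> b - t * of_bool (b \<in> g ` Z)"
    from insert obtain Q where Q: "transport_plan A B ?\<mu> ?\<nu> Q"
      "transport_cost c A B Q \<le> transport_cost c A B P - real (card Z) * t * K"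
      by auto
    have ni: "f i \<notin> f ` Z" "g i \<notin> g ` Z" using insert.prems(1,2) insert.hyps(2) by auto
    obtain Q' where Q': "transport_plan A B (?\<mu>(f i := ?\<mu> (f i) - t)) (?\<nu>(g i := ?\<nu> (g i) - t)) Q'"
      "transport_cost c A B Q' \<le> transport_cost c A B Q - t * K"
    proof (rule transport_plan_glue[OF fin _ _ Q(1) t])
      show "f i \<in> A" "g i \<in> B" "K \<le> c (f i) (g i)" using insert.prems by auto
      show "t \<le> ?\<mu> (f i)" "t \<le> ?\<nu> (g i)" using insert.prems(5,6)[of i] ni by auto
      show "c a b + K \<le> c a (g i) + c (f i) b"
        if "a \<in> A" "b \<in> B" "a \<noteq> f i" "b \<noteq> g i" for a b
        using insert.prems(8)[of i a b] that by simp
    qed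
    have "transport_plan A B (\<lambda>a. \<mu> a - t * of_bool (a \<in> f ` insert i Z))
        (\<lambda>b. \<nu> b - t * of_bool (b \<in> g ` insert i Z)) Q'"
      using Q'(1) by (rule transport_plan_cong) (use ni in auto)
    moreover have "transport_cost c A B Q' \<le> transport_cost c A B P - real (card (insert i Z)) * t * K"
      using Q(2) Q'(2) insert.hyps by (simp add: algebra_simps)
    ultimately show ?case by blast
  qed
  then show thesis using that by blast
qed

section \<open>Optimal transport for an edge and for its copies in a product\<close>

text \<open>The constants \<open>m0\<close> and \<open>m1\<close> are the minimal costs of perfect matchings between the spheres
  \<open>N\<close>, \<open>N'\<close> and between the balls \<open>A\<close>, \<open>B\<close>.\<close>

lemma star_optimal_cost:
  fixes c :: "'a \<Rightarrow> 'a \<Rightarrow> real"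
  assumes fin: "finite N" "finite N'" and card: "card N = card N'"
    and xy: "x \<notin> N" "y \<in> N" "x \<in> N'" "y \<notin> N'"
    and A: "A = insert x N" and B: "B = insert y N'"
    and cxy: "c x y = 1" and refl: "\<And>a. a \<in> A \<inter> B \<Longrightarrow> c a a = 0"
    and tri: "\<And>a z b. \<lbrakk>a \<in> A; z \<in> A \<inter> B; b \<in> B\<rbrakk> \<Longrightarrow> c a b \<le> c a z + c z b"
    and far: "\<And>a b. \<lbrakk>a \<in> A - B; b \<in> B - A\<rbrakk> \<Longrightarrow> c a b \<le> 3 \<and> 2 \<le> c a y \<and> 2 \<le> c x b"
  obtains m0 m1 where "\<And>p q. \<lbrakk>0 \<le> p; 0 \<le> q\<rbrakk> \<Longrightarrow>
    optimal_cost c A B (\<lambda>a. if a = x then p else q) (\<lambda>b. if b = y then p else q)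
      (if p \<le> q then (q - p) * m0 + p * m1 else q * m1 + (p - q))"
proof -
  have finA: "finite A" and finB: "finite B" using fin A B by auto
  have cardAB: "card A = card B" using fin card xy A B by simp
  have xA: "x \<in> A" and yB: "y \<in> B" using A B by auto
  obtain \<sigma>0 where \<sigma>0: "bij_betw \<sigma>0 N N'"
    "\<And>\<tau>. bij_betw \<tau> N N' \<Longrightarrow> (\<Sum>a\<in>N. c a (\<sigma>0 a)) \<le> (\<Sum>a\<in>N. c a (\<tau> a))"
    using minimal_matching[OF fin card] by blast
  obtain \<sigma>1 where \<sigma>1: "bij_betw \<sigma>1 A B"
    "\<And>\<tau>. bij_betw \<tau> A B \<Longrightarrow> (\<Sum>a\<in>A. c a (\<sigma>1 a)) \<le> (\<Sum>a\<in>A. c a (\<tau> a))"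
    using minimal_matching[OF finA finB cardAB] by blast
  define m0 where "m0 = (\<Sum>a\<in>N. c a (\<sigma>0 a))"
  define m1 where "m1 = (\<Sum>a\<in>A. c a (\<sigma>1 a))"
  define M0 where "M0 = (\<lambda>a b. of_bool (a \<in> N \<and> b = \<sigma>0 a) :: real)"
  define M1 where "M1 = (\<lambda>a b. of_bool (a \<in> A \<and> b = \<sigma>1 a) :: real)"
  \<comment> \<open>The unit flow from \<open>x\<close> to \<open>y\<close>, in the shape that the
    matching lemmas expect.\<close>
  define E where "E = (\<lambda>a b. of_bool (a \<in> {x} \<and> b = (\<lambda>_. y) a) :: real)"
  have NA: "N \<subseteq> A" "N' \<subseteq> B" using A B by auto
  have xyAB: "{x} \<subseteq> A" "{y} \<subseteq> B" using xA yB by auto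
  have bxy: "bij_betw (\<lambda>_. y) {x} {y}" by (simp add: bij_betw_def)
  note M0 = transport_plan_matching[OF finA finB NA \<sigma>0(1), folded M0_def]
  note M1 = transport_plan_matching[OF finA finB subset_refl subset_refl \<sigma>1(1), folded M1_def]
  note E = transport_plan_matching[OF finA finB xyAB bxy, folded E_def]
  have cost0: "transport_cost c A B M0 = m0"
    unfolding M0_def m0_def by (rule transport_cost_matching[OF finA finB NA \<sigma>0(1)])
  have cost1: "transport_cost c A B M1 = m1"
    unfolding M1_def m1_def by (rule transport_cost_matching[OF finA finB subset_refl subset_refl \<sigma>1(1)])
  have costE: "transport_cost c A B E = 1"
    unfolding E_def using transport_cost_matching[OF finA finB xyAB bxy] cxy by simp
  \<comment> \<open>Extending an optimal bijection of the spheres by \<open>x\<close> to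
    \<open>y\<close> adds \<open>c x y = 1\<close>. This makes the correction \<open>k\<close> below
    nonnegative.\<close>
  have m10: "m1 \<le> m0 + 1"
  proof -
    define s where "s = (\<lambda>a. if a = x then y else \<sigma>0 a)"
    have s: "s x = y" "\<And>a. a \<in> N \<Longrightarrow> s a = \<sigma>0 a" using xy by (auto simp: s_def)
    have "bij_betw s N N'"
      using \<sigma>0(1) s(2) by (subst bij_betw_cong[of N _ \<sigma>0]) auto
    then have "bij_betw s A B"
      using notIn_Un_bij_betw[of x N s N'] xy s(1) A B by simp
    then have "m1 \<le> (\<Sum>a\<in>A. c a (s a))"
      unfolding m1_def by (rule \<sigma>1(2))
    also have "\<dots> = 1 + m0"
      using fin xy cxy s A by (simp add: m0_def)
    finally show ?thesis by simp
  qed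
  show thesis
  proof (rule that)
    fix p q :: real
    assume p: "0 \<le> p" and q: "0 \<le> q"
    let ?\<mu> = "\<lambda>a. if a = x then p else q" and ?\<nu> = "\<lambda>b. if b = y then p else q"
    show "optimal_cost c A B ?\<mu> ?\<nu> (if p \<le> q then (q - p) * m0 + p * m1 else q * m1 + (p - q))"
    proof (cases "p \<le> q")
      case True
      then have qp: "0 \<le> q - p" by simp
      have "transport_plan A B ?\<mu> ?\<nu> (\<lambda>a b. (q - p) * M0 a b + p * M1 a b)"
        by (rule transport_plan_cong[OF transport_plan_add[OF
              transport_plan_scale[OF M0 qp] transport_plan_scale[OF M1 p]]])
          (use xy A B in auto)
      moreover have "transport_cost c A B (\<lambda>a b. (q - p) * M0 a b + p * M1 a b) = (q - p) * m0 + p * m1"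
        by (simp add: transport_cost_add transport_cost_scale cost0 cost1)
      moreover have "(q - p) * m0 + p * m1 \<le> transport_cost c A B P"
        if P: "transport_plan A B ?\<mu> ?\<nu> P" for P
      proof -
        \<comment> \<open>Raising the entry at \<open>(x, y)\<close> makes all marginals equal to \<open>q\<close>. Of the resulting mixture
          of permutations, those mapping \<open>x\<close> to \<open>y\<close> cost at least \<open>m0 + 1\<close> and have total weight at
          least \<open>q - p\<close>; the others cost at least \<open>m1\<close>. The cost \<open>c'\<close> encodes this estimate.\<close>
        define R where "R = (\<lambda>a b. P a b + (q - p) * E a b)"
        define k where "k = m0 + 1 - m1"
        define c' where "c' = (\<lambda>a b. c a b - k * E a b)"
        have R: "transport_plan A B (\<lambda>_. q) (\<lambda>_. q) R"
          unfolding R_def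
          by (rule transport_plan_cong[OF transport_plan_add[OF P transport_plan_scale[OF E qp]]]) auto
        have "q * m1 \<le> transport_cost c' A B R"
        proof (rule transport_cost_ge_matchings[OF finA finB cardAB R q])
          fix \<tau> assume \<tau>: "bij_betw \<tau> A B"
          have le1: "m1 \<le> (\<Sum>a\<in>A. c a (\<tau> a))" unfolding m1_def by (rule \<sigma>1(2)[OF \<tau>])
          show "m1 \<le> (\<Sum>a\<in>A. c' a (\<tau> a))"
          proof (cases "\<tau> x = y")
            case False
            then have "(\<Sum>a\<in>A. c' a (\<tau> a)) = (\<Sum>a\<in>A. c a (\<tau> a))"
              by (intro sum.cong) (auto simp: c'_def E_def)
            then show ?thesis using le1 by simp
          next
            \<comment> \<open>The rest of \<open>\<tau>\<close> matches the spheres, so the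
              corrected cost is at least \<open>m0 + 1 - k = m1\<close>.\<close>
            case True
            have "bij_betw \<tau> N N'"
              using notIn_Un_bij_betw3[of x N \<tau> N'] \<tau> True xy A B by simp
            then have "m0 \<le> (\<Sum>a\<in>N. c a (\<tau> a))" unfolding m0_def by (rule \<sigma>0(2))
            also have "\<dots> = (\<Sum>a\<in>N. c' a (\<tau> a))"
              using xy by (intro sum.cong) (auto simp: c'_def E_def)
            finally show ?thesis using True fin xy cxy A by (simp add: c'_def E_def k_def)
          qed
        qed
        moreover have "transport_cost c' A B R = transport_cost c A B R - k * R x y"
        proof -
          \<comment> \<open>Cost and plan enter the sum symmetrically, so \<open>R\<close> can act
            as the cost of the one-entry plan \<open>E\<close>.\<close>
          have "transport_cost c' A B R
              = transport_cost c A B R - k * transport_cost R A B E"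
            by (simp add: transport_cost_def c'_def sum_distrib_left algebra_simps
                flip: sum_subtractf)
          also have "transport_cost R A B E = R x y"
            unfolding E_def using transport_cost_matching[OF finA finB xyAB bxy] by simp
          finally show ?thesis .
        qed
        moreover have "transport_cost c A B R = transport_cost c A B P + (q - p)"
          by (simp add: R_def transport_cost_add transport_cost_scale costE)
        moreover have "k * (q - p) \<le> k * R x y"
        proof (rule mult_left_mono)
          show "q - p \<le> R x y" using P xA yB by (simp add: R_def E_def transport_plan_def)
        qed (use m10 k_def in simp)
        moreover have "k * (q - p) = m0 * (q - p) + (q - p) - q * m1 + p * m1"
          by (simp add: k_def algebra_simps)
        ultimately show ?thesis by (simp add: mult.commute)
      qed
      ultimately show ?thesis using True unfolding optimal_cost_def by auto
    next
      case False
      then have pq: "0 \<le> p - q" by simp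
      have "transport_plan A B ?\<mu> ?\<nu> (\<lambda>a b. q * M1 a b + (p - q) * E a b)"
        by (rule transport_plan_cong[OF transport_plan_add[OF
              transport_plan_scale[OF M1 q] transport_plan_scale[OF E pq]]])
          auto
      moreover have "transport_cost c A B (\<lambda>a b. q * M1 a b + (p - q) * E a b) = q * m1 + (p - q)"
        by (simp add: transport_cost_add transport_cost_scale cost1 costE)
      moreover have "q * m1 + (p - q) \<le> transport_cost c A B P"
        if P: "transport_plan A B ?\<mu> ?\<nu> P" for P
      proof -
        \<comment> \<open>Mass shared by both measures stays in place. Of the rest, \<open>p - q\<close> can be routed from \<open>x\<close>
          to \<open>y\<close>, because a detour through \<open>a \<rightarrow> y\<close> and \<open>x \<rightarrow> b\<close> costs at least \<open>2 + 2\<close>, whereas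
          \<open>x \<rightarrow> y\<close> and \<open>a \<rightarrow> b\<close> cost at most \<open>1 + 3\<close>.\<close>
        define Z where "Z = A \<inter> B"
        have Z: "finite Z" "Z \<subseteq> A" "Z \<subseteq> B" "x \<in> Z" "y \<in> Z"
          using finA A B xy by (auto simp: Z_def)
        let ?\<mu>1 = "\<lambda>a. ?\<mu> a - q * of_bool (a \<in> id ` Z)" and ?\<nu>1 = "\<lambda>b. ?\<nu> b - q * of_bool (b \<in> id ` Z)"
        obtain Q where Q: "transport_plan A B ?\<mu>1 ?\<nu>1 Q"
          "transport_cost c A B Q \<le> transport_cost c A B P - real (card Z) * q * 0"
        proof (rule transport_plan_glue_set[OF finA finB Z(1) _ _ _ _ P q, where c = c and K = 0])
          show "c a b + 0 \<le> c a (id i) + c (id i) b" if "i \<in> Z" "a \<in> A" "b \<in> B" for i a b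
            using tri that by (simp add: Z_def)
          show "0 \<le> c (id i) (id i)" if "i \<in> Z" for i using refl that by (simp add: Z_def)
        qed (use Z False in auto)
        obtain Q' where Q': "transport_plan A B (?\<mu>1(x := ?\<mu>1 x - (p - q))) (?\<nu>1(y := ?\<nu>1 y - (p - q))) Q'"
          "transport_cost c A B Q' \<le> transport_cost c A B Q - (p - q) * 1"
        proof (rule transport_plan_glue[OF finA finB xA yB Q(1), where c = c and K = 1 and t = "p - q"])
          fix a b assume ab: "a \<in> A" "b \<in> B" "a \<noteq> x" "b \<noteq> y" "0 < ?\<mu>1 a" "0 < ?\<nu>1 b"
          \<comment> \<open>After the cancellation, the only common vertex that may still carry mass
            is \<open>x\<close> on the source side and \<open>y\<close> on the target side.\<close>
          then have "a \<in> A - B" "b \<in> B - A" by (auto simp: Z_def split: if_splits)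
          then show "c a b + 1 \<le> c a y + c x b" using far[of a b] by simp
        qed (use Z False cxy in auto)
        define D where "D = (\<lambda>a b. of_bool (a \<in> Z \<and> b = id a) :: real)"
        note D = transport_plan_matching[OF finA finB Z(2,3) bij_betw_id, folded D_def]
        have costD: "transport_cost c A B D = 0"
          unfolding D_def transport_cost_matching[OF finA finB Z(2,3) bij_betw_id]
          using refl by (simp add: Z_def)
        \<comment> \<open>Returning \<open>q\<close> to the common vertices costs nothing and makes
          all marginals equal to \<open>q\<close>, so Birkhoff's bound applies.\<close>
        have "transport_plan A B (\<lambda>_. q) (\<lambda>_. q) (\<lambda>a b. Q' a b + q * D a b)"
          by (rule transport_plan_cong[OF transport_plan_add[OF Q'(1) transport_plan_scale[OF D q]]])
            (use Z in auto)
        then have "q * m1 \<le> transport_cost c A B (\<lambda>a b. Q' a b + q * D a b)"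
          using transport_cost_ge_matchings[OF finA finB cardAB _ q] \<sigma>1(2) by (simp add: m1_def)
        then show ?thesis
          using Q(2) Q'(2) by (simp add: transport_cost_add transport_cost_scale costD)
      qed
      ultimately show ?thesis using False unfolding optimal_cost_def by auto
    qed
  qed
qed

text \<open>By the gluing lemma with \<open>K = 1\<close>, sending each \<open>(x, w)\<close> to \<open>(y, w)\<close> does not increase the
  cost; what remains is a plan in the layer over \<open>v\<close>.\<close>

lemma product_optimal_cost:
  fixes c :: "'a \<Rightarrow> 'a \<Rightarrow> real" and h :: "'b \<Rightarrow> 'b \<Rightarrow> real"
  assumes fin: "finite A" "finite B" "finite W" and xA: "x \<in> A" and yB: "y \<in> B" and v: "v \<notin> W"
    and cxy: "c x y = 1" and ctri: "\<And>a b. \<lbrakk>a \<in> A; b \<in> B\<rbrakk> \<Longrightarrow> c a b \<le> c a y + 1 + c x b"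
    and hv: "h v v = 0" "\<And>w. w \<in> W \<Longrightarrow> h v w = 1" "\<And>w. w \<in> W \<Longrightarrow> h w v = 1"
    and hrefl: "\<And>w. w \<in> W \<Longrightarrow> h w w = 0" and hpos: "\<And>w w'. 0 \<le> h w w'"
    and htri: "\<And>u w w'. \<lbrakk>u \<in> W; w \<in> W; w' \<in> W\<rbrakk> \<Longrightarrow> h u w' \<le> h u w + h w w'"
    and q: "0 \<le> q" and opt: "optimal_cost c A B \<mu> \<nu> m"
  shows "optimal_cost (\<lambda>r s. c (fst r) (fst s) + h (snd r) (snd s))
    (A \<times> {v} \<union> {x} \<times> W) (B \<times> {v} \<union> {y} \<times> W)
    (\<lambda>r. if snd r = v then \<mu> (fst r) else q) (\<lambda>s. if snd s = v then \<nu> (fst s) else q)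
    (m + real (card W) * q)"
proof -
  define A' where "A' = A \<times> {v} \<union> {x} \<times> W"
  define B' where "B' = B \<times> {v} \<union> {y} \<times> W"
  define c' where "c' = (\<lambda>r s. c (fst r) (fst s) + h (snd r) (snd s))"
  define \<mu>' where "\<mu>' = (\<lambda>r. if snd r = v then \<mu> (fst r) else q)"
  define \<nu>' where "\<nu>' = (\<lambda>s. if snd s = v then \<nu> (fst s) else q)"
  have fin': "finite A'" "finite B'" using fin by (auto simp: A'_def B'_def)
  have sum_union: "(\<Sum>r\<in>S \<times> {v} \<union> {z} \<times> W. F r) = (\<Sum>a\<in>S. F (a, v)) + (\<Sum>w\<in>W. F (z, w))"
    if "finite S" for S :: "'a set" and z and F :: "'a \<times> 'b \<Rightarrow> real"
  proof -
    have "(\<Sum>r\<in>S \<times> {v} \<union> {z} \<times> W. F r) = (\<Sum>r\<in>S \<times> {v}. F r) + (\<Sum>r\<in>{z} \<times> W. F r)"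
      using v that fin by (intro sum.union_disjoint) auto
    also have "(\<Sum>r\<in>S \<times> {v}. F r) = (\<Sum>a\<in>S. F (a, v))"
      by (rule sum.reindex_bij_witness[where i = "\<lambda>a. (a, v)" and j = fst]) auto
    also have "(\<Sum>r\<in>{z} \<times> W. F r) = (\<Sum>w\<in>W. F (z, w))"
      by (rule sum.reindex_bij_witness[where i = "\<lambda>w. (z, w)" and j = snd]) auto
    finally show ?thesis .
  qed
  note sumA = sum_union[OF fin(1), of _ x, folded A'_def]
    and sumB = sum_union[OF fin(2), of _ y, folded B'_def]
  have nv: "w \<noteq> v" "v \<noteq> w" if "w \<in> W" for w using v that by auto
  have A'I: "(a, v) \<in> A'" if "a \<in> A" for a using that by (simp add: A'_def)
  have B'I: "(b, v) \<in> B'" if "b \<in> B" for b using that by (simp add: B'_def)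
  have WI: "(x, w) \<in> A'" "(y, w) \<in> B'" if "w \<in> W" for w using that by (simp_all add: A'_def B'_def)
  have costI: "transport_cost c' A' B' R =
      (\<Sum>a\<in>A. (\<Sum>b\<in>B. c' (a, v) (b, v) * R (a, v) (b, v)) + (\<Sum>w\<in>W. c' (a, v) (y, w) * R (a, v) (y, w)))
      + (\<Sum>u\<in>W. (\<Sum>b\<in>B. c' (x, u) (b, v) * R (x, u) (b, v)) + (\<Sum>w\<in>W. c' (x, u) (y, w) * R (x, u) (y, w)))"
    for R unfolding transport_cost_def sumA sumB ..
  obtain P where P: "transport_plan A B \<mu> \<nu> P" "transport_cost c A B P = m"
    using opt by (auto simp: optimal_cost_def)
  \<comment> \<open>An optimal plan in the layer over \<open>v\<close>, and \<open>q\<close>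
    straight from \<open>(x, w)\<close> to \<open>(y, w)\<close>.\<close>
  define P' where "P' = (\<lambda>r s. if snd r = v \<and> snd s = v then P (fst r) (fst s)
    else if snd r = snd s then q else 0)"
  have "transport_plan A' B' \<mu>' \<nu>' P'"
    unfolding transport_plan_def
  proof (intro conjI ballI)
    show "0 \<le> P' r s" if "r \<in> A'" "s \<in> B'" for r s
      using that P(1) q v by (auto simp: P'_def A'_def B'_def transport_plan_def)
    show "(\<Sum>s\<in>B'. P' r s) = \<mu>' r" if "r \<in> A'" for r
      using that P(1) v fin(3) unfolding sumB
      by (auto simp: A'_def P'_def \<mu>'_def transport_plan_def nv sum.delta cong: sum.cong)
    show "(\<Sum>r\<in>A'. P' r s) = \<nu>' s" if "s \<in> B'" for s
      using that P(1) v fin(3) unfolding sumA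
      by (auto simp: B'_def P'_def \<nu>'_def transport_plan_def nv sum.delta' cong: sum.cong)
  qed
  moreover have "transport_cost c' A' B' P' = m + real (card W) * q"
  proof -
    have "(\<Sum>w\<in>W. c' (x, u) (y, w) * P' (x, u) (y, w)) = q" if u: "u \<in> W" for u
    proof -
      have "(\<Sum>w\<in>W. c' (x, u) (y, w) * P' (x, u) (y, w)) = (\<Sum>w\<in>W. if w = u then q else 0)"
        using u by (intro sum.cong) (auto simp: c'_def P'_def cxy hrefl nv)
      then show ?thesis using u fin(3) by simp
    qed
    moreover have "(\<Sum>a\<in>A. \<Sum>b\<in>B. c' (a, v) (b, v) * P' (a, v) (b, v)) = m"
      using P(2) by (simp add: c'_def P'_def hv transport_cost_def)
    moreover have "(\<Sum>w\<in>W. c' (a, v) (y, w) * P' (a, v) (y, w)) = 0" for a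
      by (intro sum.neutral) (auto simp: P'_def nv)
    moreover have "(\<Sum>b\<in>B. c' (x, u) (b, v) * P' (x, u) (b, v)) = 0" if "u \<in> W" for u
      using nv[OF that] by (simp add: P'_def)
    ultimately show ?thesis unfolding costI by simp
  qed
  moreover have "m + real (card W) * q \<le> transport_cost c' A' B' R"
    if R: "transport_plan A' B' \<mu>' \<nu>' R" for R
  proof -
    let ?f = "\<lambda>w. (x, w)" and ?g = "\<lambda>w. (y, w)"
    obtain Q where Q: "transport_plan A' B' (\<lambda>r. \<mu>' r - q * of_bool (r \<in> ?f ` W))
        (\<lambda>s. \<nu>' s - q * of_bool (s \<in> ?g ` W)) Q"
      "transport_cost c' A' B' Q \<le> transport_cost c' A' B' R - real (card W) * q * 1"
    proof (rule transport_plan_glue_set[OF fin' fin(3) _ _ _ _ R q, where f = ?f and g = ?g and c = c' and K = 1])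
      fix w r s assume w: "w \<in> W" and r: "r \<in> A'" and s: "s \<in> B'"
      \<comment> \<open>With both points over \<open>v\<close> the detour pays 2 in the second
        coordinate, so \<open>ctri\<close> suffices. With one point over \<open>v\<close> the claim
        reduces to \<open>hpos\<close>, with none to \<open>htri\<close>.\<close>
      show "c' r s + 1 \<le> c' r (y, w) + c' (x, w) s"
      proof (cases "snd r = v"; cases "snd s = v")
        assume "snd r = v" "snd s = v"
        moreover from this have "fst r \<in> A" "fst s \<in> B"
          using r s v by (auto simp: A'_def B'_def)
        ultimately show ?thesis using ctri[of "fst r" "fst s"] w hv by (simp add: c'_def)
      next
        assume "snd r = v" "snd s \<noteq> v"
        then have "fst s = y" "snd s \<in> W" using s by (auto simp: B'_def)
        then show ?thesis using \<open>snd r = v\<close> w hv hpos[of w "snd s"] cxy by (simp add: c'_def)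
      next
        assume "snd r \<noteq> v" "snd s = v"
        then have "fst r = x" "snd r \<in> W" using r by (auto simp: A'_def)
        then show ?thesis using \<open>snd s = v\<close> w hv hpos[of "snd r" w] cxy by (simp add: c'_def)
      next
        assume "snd r \<noteq> v" "snd s \<noteq> v"
        then have "fst r = x" "snd r \<in> W" "fst s = y" "snd s \<in> W"
          using r s by (auto simp: A'_def B'_def)
        then show ?thesis using htri[of "snd r" w "snd s"] w cxy by (simp add: c'_def)
      qed
    qed (use WI nv cxy hrefl in \<open>auto simp: inj_on_def \<mu>'_def \<nu>'_def c'_def\<close>)
    have Q0: "0 \<le> Q r s" if "r \<in> A'" "s \<in> B'" for r s
      using Q(1) that by (simp add: transport_plan_def)
    \<comment> \<open>The removal leaves marginal 0 at the points over \<open>W\<close>, so the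
      nonnegative entries there vanish and \<open>Q\<close> lives in the layer over
      \<open>v\<close>.\<close>
    have row0: "Q (x, w) s = 0" if "w \<in> W" "s \<in> B'" for w s
    proof -
      have "(\<Sum>s\<in>B'. Q (x, w) s) = 0"
        using Q(1) WI nv that by (simp add: transport_plan_def \<mu>'_def)
      then show ?thesis using Q0 WI that fin' by (simp add: sum_nonneg_eq_0_iff)
    qed
    have col0: "Q r (y, w) = 0" if "w \<in> W" "r \<in> A'" for w r
    proof -
      have "(\<Sum>r\<in>A'. Q r (y, w)) = 0"
        using Q(1) WI nv that by (simp add: transport_plan_def \<nu>'_def)
      then show ?thesis using Q0 WI that fin' by (simp add: sum_nonneg_eq_0_iff)
    qed
    have "transport_plan A B \<mu> \<nu> (\<lambda>a b. Q (a, v) (b, v))"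
      unfolding transport_plan_def
    proof (intro conjI ballI)
      show "0 \<le> Q (a, v) (b, v)" if "a \<in> A" "b \<in> B" for a b
        using that Q0 A'I B'I by simp
      show "(\<Sum>b\<in>B. Q (a, v) (b, v)) = \<mu> a" if a: "a \<in> A" for a
      proof -
        have "(\<Sum>s\<in>B'. Q (a, v) s) = \<mu> a"
          using Q(1) A'I[OF a] nv by (auto simp: transport_plan_def \<mu>'_def)
        then show ?thesis unfolding sumB using col0 A'I[OF a] by simp
      qed
      show "(\<Sum>a\<in>A. Q (a, v) (b, v)) = \<nu> b" if b: "b \<in> B" for b
      proof -
        have "(\<Sum>r\<in>A'. Q r (b, v)) = \<nu> b"
          using Q(1) B'I[OF b] nv by (auto simp: transport_plan_def \<nu>'_def)
        then show ?thesis unfolding sumA using row0 B'I[OF b] by simp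
      qed
    qed
    then have "m \<le> transport_cost c A B (\<lambda>a b. Q (a, v) (b, v))"
      using opt by (simp add: optimal_cost_def)
    also have "\<dots> = transport_cost c' A' B' Q"
      unfolding costI using row0 col0 A'I B'I WI
      by (simp add: transport_cost_def c'_def hv)
    finally show ?thesis using Q(2) by simp
  qed
  ultimately show ?thesis
    unfolding optimal_cost_def A'_def B'_def c'_def \<mu>'_def \<nu>'_def by blast
qed

section \<open>Graph distance\<close>

text \<open>Real-valued, to match the transport costs. \<open>the_enat\<close> is unspecified at
  infinity, so facts that need a finite distance assume a walk or an edge.\<close>

definition graph_distance :: "'a sgraph \<Rightarrow> 'a \<Rightarrow> 'a \<Rightarrow> real"
  where "graph_distance G x y = real (the_enat (graph_dist G x y))"

lemma graph_dist_le: "(adj G ^^ n) x y \<Longrightarrow> graph_dist G x y \<le> enat n"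
  unfolding graph_dist_def by (rule INF_lower) simp

lemma graph_dist_attained:
  assumes "(adj G ^^ n) x y"
  obtains k where "(adj G ^^ k) x y" and "graph_dist G x y = enat k"
proof -
  let ?S = "enat ` {n. (adj G ^^ n) x y}"
  have "enat n \<in> ?S" using assms by blast
  then have "Inf ?S \<in> ?S" unfolding Inf_enat_def by (metis LeastI empty_iff)
  then show thesis using that by (auto simp: graph_dist_def)
qed

lemma graph_distance_le: "(adj G ^^ n) x y \<Longrightarrow> graph_distance G x y \<le> real n"
  using graph_dist_le[of n G x y] by (cases "graph_dist G x y") (auto simp: graph_distance_def)

lemma graph_distance_attained:
  assumes "(adj G ^^ n) x y"
  obtains k where "(adj G ^^ k) x y" and "graph_distance G x y = real k"
  using assms by (rule graph_dist_attained) (simp add: graph_distance_def that)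

lemma graph_distance_nonneg: "0 \<le> graph_distance G x y"
  by (simp add: graph_distance_def)

lemma graph_distance_refl: "graph_distance G x x = 0"
  using graph_distance_le[of 0 G x x] graph_distance_nonneg[of G x x] by simp

lemma graph_distance_triangle:
  assumes "(adj G ^^ k) x y" and "(adj G ^^ l) y z"
  shows "graph_distance G x z \<le> graph_distance G x y + graph_distance G y z"
proof -
  obtain k' l' where "(adj G ^^ k') x y" "graph_distance G x y = real k'"
    "(adj G ^^ l') y z" "graph_distance G y z = real l'"
    using graph_distance_attained assms by metis
  then show ?thesis using graph_distance_le[OF relpowp_trans] by fastforce
qed

lemma graph_distance_ge_1:
  assumes "(adj G ^^ n) x y" and "x \<noteq> y"
  shows "1 \<le> graph_distance G x y"
proof -
  obtain k where k: "(adj G ^^ k) x y" "graph_distance G x y = real k"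
    using graph_distance_attained[OF assms(1)] .
  then have "k \<noteq> 0" using assms(2) by (metis relpowp_0_E)
  then show ?thesis using k by simp
qed

lemma graph_distance_adj:
  assumes "adj G x y" and "x \<noteq> y"
  shows "graph_distance G x y = 1"
  using graph_distance_le[of 1 G x y] graph_distance_ge_1[of 1 G x y] assms
  by (simp only: relpowp_1) simp

lemma graph_distance_ge_2:
  assumes "(adj G ^^ n) x y" and "x \<noteq> y" and "\<not> adj G x y"
  shows "2 \<le> graph_distance G x y"
proof -
  obtain k where k: "(adj G ^^ k) x y" "graph_distance G x y = real k"
    using graph_distance_attained[OF assms(1)] .
  have "k \<noteq> 0" "k \<noteq> 1" using k(1) assms(2,3) by (metis relpowp_0_E, metis relpowp_1)
  then show ?thesis using k(2) by simp
qed

lemma ennreal_graph_dist: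
  assumes "(adj G ^^ n) x y"
  shows "ennreal_of_enat (graph_dist G x y) = ennreal (graph_distance G x y)"
  using graph_dist_attained[OF assms]
  by (metis ennreal_of_enat_enat ennreal_of_nat_eq_real_of_nat graph_distance_def the_enat.simps)

context locally_finite_graph
begin

lemma walk_vertex: "(adj G ^^ n) x y \<Longrightarrow> x \<in> vertices G \<Longrightarrow> y \<in> vertices G"
  by (induction n arbitrary: y) (auto dest: adj_vertices)

end

section \<open>Distances in a Cartesian product\<close>

text \<open>Every step moves one coordinate, so the steps sort into one walk per factor. Conversely,
  the walk in \<open>G\<close> is run first and the walk in \<open>H\<close> after it; the vertex
  hypotheses make the resting coordinate a vertex, as product adjacency demands.\<close>

lemma cartesian_product_walk_iff:
  assumes "locally_finite_graph G" and "a \<in> vertices G" and "\<alpha> \<in> vertices H"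
  shows "(adj (cartesian_product G H) ^^ n) (a, \<alpha>) (b, \<beta>) \<longleftrightarrow>
    (\<exists>k l. n = k + l \<and> (adj G ^^ k) a b \<and> (adj H ^^ l) \<alpha> \<beta>)"
proof
  assume "(adj (cartesian_product G H) ^^ n) (a, \<alpha>) (b, \<beta>)"
  then show "\<exists>k l. n = k + l \<and> (adj G ^^ k) a b \<and> (adj H ^^ l) \<alpha> \<beta>"
  proof (induction n arbitrary: b \<beta>)
    case 0
    then have "(adj G ^^ 0) a b \<and> (adj H ^^ 0) \<alpha> \<beta>" by simp
    then show ?case by (metis add_0)
  next
    case (Suc n)
    then obtain c \<gamma> where c: "(adj (cartesian_product G H) ^^ n) (a, \<alpha>) (c, \<gamma>)"
      "adj (cartesian_product G H) (c, \<gamma>) (b, \<beta>)"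
      by (metis relpowp_Suc_E surj_pair)
    obtain k l where kl: "n = k + l" "(adj G ^^ k) a c" "(adj H ^^ l) \<alpha> \<gamma>"
      using Suc.IH[OF c(1)] by blast
    from c(2) consider "c = b" "adj H \<gamma> \<beta>" | "\<gamma> = \<beta>" "adj G c b"
      by (auto simp: cartesian_product_def)
    then show ?case
    proof cases
      case 1
      then show ?thesis using kl relpowp_Suc_I[of l "adj H"] by (metis add_Suc_right)
    next
      case 2
      then show ?thesis using kl relpowp_Suc_I[of k "adj G"] by (metis add_Suc)
    qed
  qed
next
  assume "\<exists>k l. n = k + l \<and> (adj G ^^ k) a b \<and> (adj H ^^ l) \<alpha> \<beta>"
  then obtain k l where n: "n = k + l" and k: "(adj G ^^ k) a b" and l: "(adj H ^^ l) \<alpha> \<beta>"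
    by blast
  have "(adj (cartesian_product G H) ^^ k) (a, \<alpha>) (b, \<alpha>)"
    using k
  proof (induction k arbitrary: b)
    case (Suc k)
    then obtain c where c: "(adj G ^^ k) a c" "adj G c b" by (metis relpowp_Suc_E)
    show ?case
      by (rule relpowp_Suc_I[OF Suc.IH[OF c(1)]]) (simp add: cartesian_product_def c(2) assms(3))
  qed simp
  moreover have b: "b \<in> vertices G" using locally_finite_graph.walk_vertex[OF assms(1) k assms(2)] .
  have "(adj (cartesian_product G H) ^^ l) (b, \<alpha>) (b, \<beta>)"
    using l
  proof (induction l arbitrary: \<beta>)
    case (Suc l)
    then obtain \<gamma> where \<gamma>: "(adj H ^^ l) \<alpha> \<gamma>" "adj H \<gamma> \<beta>" by (metis relpowp_Suc_E)
    show ?case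
      by (rule relpowp_Suc_I[OF Suc.IH[OF \<gamma>(1)]]) (simp add: cartesian_product_def \<gamma>(2) b)
  qed simp
  ultimately show "(adj (cartesian_product G H) ^^ n) (a, \<alpha>) (b, \<beta>)"
    unfolding n by (rule relpowp_trans)
qed

text \<open>Joining shortest walks of the factors gives one inequality, splitting a shortest walk of
  the product the other.\<close>

lemma graph_distance_cartesian_product:
  assumes "locally_finite_graph G" and "a \<in> vertices G" and "\<alpha> \<in> vertices H"
    and "(adj G ^^ k) a b" and "(adj H ^^ l) \<alpha> \<beta>"
  shows "graph_distance (cartesian_product G H) (a, \<alpha>) (b, \<beta>)
    = graph_distance G a b + graph_distance H \<alpha> \<beta>"
proof (rule antisym)
  note walk = cartesian_product_walk_iff[OF assms(1-3)]
  obtain k' l' where "(adj G ^^ k') a b" "graph_distance G a b = real k'"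
    "(adj H ^^ l') \<alpha> \<beta>" "graph_distance H \<alpha> \<beta> = real l'"
    using graph_distance_attained assms(4,5) by metis
  moreover from this have "(adj (cartesian_product G H) ^^ (k' + l')) (a, \<alpha>) (b, \<beta>)"
    using walk by blast
  ultimately show "graph_distance (cartesian_product G H) (a, \<alpha>) (b, \<beta>)
      \<le> graph_distance G a b + graph_distance H \<alpha> \<beta>"
    using graph_distance_le by fastforce
  have "(adj (cartesian_product G H) ^^ (k + l)) (a, \<alpha>) (b, \<beta>)" using walk assms(4,5) by blast
  then obtain n where n: "(adj (cartesian_product G H) ^^ n) (a, \<alpha>) (b, \<beta>)"
    "graph_distance (cartesian_product G H) (a, \<alpha>) (b, \<beta>) = real n"
    by (rule graph_distance_attained)
  then obtain i j where "n = i + j" "(adj G ^^ i) a b" "(adj H ^^ j) \<alpha> \<beta>" using walk by blast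
  then show "graph_distance G a b + graph_distance H \<alpha> \<beta>
      \<le> graph_distance (cartesian_product G H) (a, \<alpha>) (b, \<beta>)"
    using n(2) graph_distance_le[of i G a b] graph_distance_le[of j H \<alpha> \<beta>] by simp
qed

lemma locally_finite_graph_cartesian_product:
  assumes G: "locally_finite_graph G" and H: "locally_finite_graph H"
  shows "locally_finite_graph (cartesian_product G H)"
proof
  fix r s
  assume "adj (cartesian_product G H) r s"
  then show "r \<in> vertices (cartesian_product G H) \<and> s \<in> vertices (cartesian_product G H)"
    and "adj (cartesian_product G H) s r"
    using locally_finite_graph.adj_vertices[OF G] locally_finite_graph.adj_vertices[OF H]
      locally_finite_graph.adj_sym[OF G] locally_finite_graph.adj_sym[OF H]
    by (auto simp: cartesian_product_def)
next
  show "\<not> adj (cartesian_product G H) r r" for r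
    using locally_finite_graph.adj_irrefl[OF G] locally_finite_graph.adj_irrefl[OF H]
    by (auto simp: cartesian_product_def)
next
  fix r assume "r \<in> vertices (cartesian_product G H)"
  then have "finite ({s. adj G (fst r) s} \<times> {snd r} \<union> {fst r} \<times> {s. adj H (snd r) s})"
    using locally_finite_graph.locally_finite[OF G] locally_finite_graph.locally_finite[OF H]
    by (auto simp: cartesian_product_def)
  then show "finite {s. adj (cartesian_product G H) r s}"
    by (rule rev_finite_subset) (auto simp: cartesian_product_def)
qed

section \<open>Wasserstein distance and curvature\<close>

lemma couplings_zero:
  assumes "\<pi> \<in> couplings V \<mu> \<nu>" and "u \<in> V" and "v \<in> V" and "\<mu> u = 0 \<or> \<nu> v = 0"
  shows "\<pi> (u, v) = 0"
  using assms(4)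
proof
  assume "\<mu> u = 0"
  moreover have "((\<lambda>v. \<pi> (u, v)) has_sum \<mu> u) V" using assms(1,2) by (simp add: couplings_def)
  ultimately have "((\<lambda>v. \<pi> (u, v)) has_sum 0) V" by simp
  then show ?thesis
    by (rule nonneg_has_sum_le_0D) (use assms(1-3) in \<open>auto simp: couplings_def\<close>)
next
  assume "\<nu> v = 0"
  moreover have "((\<lambda>u. \<pi> (u, v)) has_sum \<nu> v) V" using assms(1,3) by (simp add: couplings_def)
  ultimately have "((\<lambda>u. \<pi> (u, v)) has_sum 0) V" by simp
  then show ?thesis
    by (rule nonneg_has_sum_le_0D) (use assms(1-3) in \<open>auto simp: couplings_def\<close>)
qed

lemma has_sum_finite_support:
  fixes f :: "'a \<Rightarrow> 'b::{comm_monoid_add, t2_space}"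
  assumes "finite F" "F \<subseteq> V" and "\<And>v. v \<in> V - F \<Longrightarrow> f v = 0"
  shows "(f has_sum s) V \<longleftrightarrow> s = sum f F"
proof -
  have "(f has_sum s) V \<longleftrightarrow> (f has_sum s) F"
    using assms by (intro has_sum_cong_neutral) auto
  also have "\<dots> \<longleftrightarrow> s = sum f F"
    using infsumI[of f F s] assms(1) by auto
  finally show ?thesis .
qed

lemma infsum_finite_support:
  fixes f :: "'a \<Rightarrow> 'b::{comm_monoid_add, t2_space}"
  assumes "finite F" "F \<subseteq> V" and "\<And>v. v \<in> V - F \<Longrightarrow> f v = 0"
  shows "infsum f V = sum f F"
  using has_sum_finite_support[OF assms] by (simp add: infsumI)

text \<open>Couplings vanish where a marginal does, so the infinite sums collapse to
  \<open>A\<close> and \<open>B\<close>. Walks make the distances finite, and \<open>le1\<close>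
  keeps the entries of an optimal plan in \<open>{0..1}\<close>.\<close>

lemma wasserstein_eq:
  assumes fin: "finite A" "finite B" and sub: "A \<subseteq> vertices G" "B \<subseteq> vertices G"
    and supp: "\<And>u. u \<in> vertices G - A \<Longrightarrow> \<mu> u = 0" "\<And>v. v \<in> vertices G - B \<Longrightarrow> \<nu> v = 0"
    and le1: "\<And>u. u \<in> A \<Longrightarrow> \<mu> u \<le> 1"
    and conn: "\<And>a b. \<lbrakk>a \<in> A; b \<in> B\<rbrakk> \<Longrightarrow> \<exists>n. (adj G ^^ n) a b"
    and opt: "optimal_cost (graph_distance G) A B \<mu> \<nu> w"
  shows "wasserstein G \<mu> \<nu> = ennreal w"
proof -
  let ?V = "vertices G"
  \<comment> \<open>Stated for any \<open>\<pi>\<close> concentrated on \<open>A \<times> B\<close>,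
    to cover both arbitrary couplings and the optimal plan extended by zero.\<close>
  have cost: "(\<Sum>\<^sub>\<infinity>u\<in>?V. \<Sum>\<^sub>\<infinity>v\<in>?V. ennreal_of_enat (graph_dist G u v) * ennreal (\<pi> (u, v)))
      = ennreal (transport_cost (graph_distance G) A B (\<lambda>u v. \<pi> (u, v)))"
    if nonneg: "\<And>a b. \<lbrakk>a \<in> A; b \<in> B\<rbrakk> \<Longrightarrow> 0 \<le> \<pi> (a, b)"
      and zero: "\<And>u v. \<lbrakk>u \<in> ?V; v \<in> ?V; u \<notin> A \<or> v \<notin> B\<rbrakk> \<Longrightarrow> \<pi> (u, v) = 0" for \<pi>
  proof -
    let ?e = "\<lambda>u v. ennreal_of_enat (graph_dist G u v) * ennreal (\<pi> (u, v))"
    have inner: "(\<Sum>\<^sub>\<infinity>v\<in>?V. ?e u v) = (\<Sum>v\<in>B. ?e u v)" if "u \<in> ?V" for u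
      using fin sub zero that by (intro infsum_finite_support) auto
    have "(\<Sum>\<^sub>\<infinity>u\<in>?V. \<Sum>\<^sub>\<infinity>v\<in>?V. ?e u v) = (\<Sum>u\<in>A. \<Sum>\<^sub>\<infinity>v\<in>?V. ?e u v)"
      using fin sub zero inner by (intro infsum_finite_support) auto
    also have "\<dots> = (\<Sum>u\<in>A. \<Sum>v\<in>B. ennreal (graph_distance G u v * \<pi> (u, v)))"
    proof (intro sum.cong refl)
      fix u assume u: "u \<in> A"
      have "?e u v = ennreal (graph_distance G u v * \<pi> (u, v))" if "v \<in> B" for v
        using conn[OF u that] by (auto simp: ennreal_graph_dist ennreal_mult' graph_distance_nonneg)
      then show "(\<Sum>\<^sub>\<infinity>v\<in>?V. ?e u v) = (\<Sum>v\<in>B. ennreal (graph_distance G u v * \<pi> (u, v)))"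
        using inner u sub by auto
    qed
    also have "\<dots> = ennreal (transport_cost (graph_distance G) A B (\<lambda>u v. \<pi> (u, v)))"
      unfolding transport_cost_def using nonneg
      by (subst sum_ennreal[symmetric])
        (auto intro!: sum_nonneg sum.cong simp: graph_distance_nonneg sum_ennreal)
    finally show ?thesis .
  qed
  have lower: "ennreal w \<le> (\<Sum>\<^sub>\<infinity>u\<in>?V. \<Sum>\<^sub>\<infinity>v\<in>?V. ennreal_of_enat (graph_dist G u v) * ennreal (\<pi> (u, v)))"
    if \<pi>: "\<pi> \<in> couplings ?V \<mu> \<nu>" for \<pi>
  proof -
    have zero: "\<pi> (u, v) = 0" if "u \<in> ?V" "v \<in> ?V" "u \<notin> A \<or> v \<notin> B" for u v
      using couplings_zero[OF \<pi>] supp that by blast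
    have nonneg: "0 \<le> \<pi> (a, b)" if "a \<in> A" "b \<in> B" for a b
      using \<pi> sub that by (auto simp: couplings_def)
    have "transport_plan A B \<mu> \<nu> (\<lambda>u v. \<pi> (u, v))"
      unfolding transport_plan_def
    proof (intro conjI ballI)
      show "(\<Sum>v\<in>B. \<pi> (u, v)) = \<mu> u" if "u \<in> A" for u
        using \<pi> that sub fin zero has_sum_finite_support[of B ?V "\<lambda>v. \<pi> (u, v)" "\<mu> u"]
        by (auto simp: couplings_def)
      show "(\<Sum>u\<in>A. \<pi> (u, v)) = \<nu> v" if "v \<in> B" for v
        using \<pi> that sub fin zero has_sum_finite_support[of A ?V "\<lambda>u. \<pi> (u, v)" "\<nu> v"]
        by (auto simp: couplings_def)
    qed (use nonneg in auto)
    then have "w \<le> transport_cost (graph_distance G) A B (\<lambda>u v. \<pi> (u, v))"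
      using opt by (simp add: optimal_cost_def)
    then show ?thesis by (subst cost) (use nonneg zero ennreal_leI in auto)
  qed
  obtain P where P: "transport_plan A B \<mu> \<nu> P" "transport_cost (graph_distance G) A B P = w"
    using opt by (auto simp: optimal_cost_def)
  define \<pi> where "\<pi> = (\<lambda>(u, v). if u \<in> A \<and> v \<in> B then P u v else 0)"
  have "\<pi> \<in> couplings ?V \<mu> \<nu>"
    unfolding couplings_def
  proof (intro CollectI conjI ballI)
    show "\<pi> (u, v) \<in> {0..1}" if "u \<in> ?V" "v \<in> ?V" for u v
    proof (cases "u \<in> A \<and> v \<in> B")
      case True
      then have "P u v \<le> (\<Sum>v\<in>B. P u v)"
        using P(1) fin by (intro member_le_sum) (auto simp: transport_plan_def)
      then have "P u v \<le> 1" using P(1) True le1[of u] by (simp add: transport_plan_def)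
      then show ?thesis using P(1) True by (simp add: \<pi>_def transport_plan_def)
    qed (auto simp: \<pi>_def)
    show "((\<lambda>v. \<pi> (u, v)) has_sum \<mu> u) ?V" if "u \<in> ?V" for u
    proof (subst has_sum_finite_support[OF fin(2) sub(2)])
      show "\<mu> u = (\<Sum>v\<in>B. \<pi> (u, v))"
        using P(1) supp(1) that by (cases "u \<in> A") (auto simp: \<pi>_def transport_plan_def)
    qed (auto simp: \<pi>_def)
    show "((\<lambda>u. \<pi> (u, v)) has_sum \<nu> v) ?V" if "v \<in> ?V" for v
    proof (subst has_sum_finite_support[OF fin(1) sub(1)])
      show "\<nu> v = (\<Sum>u\<in>A. \<pi> (u, v))"
        using P(1) supp(2) that by (cases "v \<in> B") (auto simp: \<pi>_def transport_plan_def)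
    qed (auto simp: \<pi>_def)
  qed
  moreover have "(\<Sum>\<^sub>\<infinity>u\<in>?V. \<Sum>\<^sub>\<infinity>v\<in>?V. ennreal_of_enat (graph_dist G u v) * ennreal (\<pi> (u, v))) = ennreal w"
  proof -
    have "transport_cost (graph_distance G) A B (\<lambda>u v. \<pi> (u, v)) = w"
      using P(2) by (simp add: transport_cost_def \<pi>_def)
    moreover have "0 \<le> \<pi> (a, b)" if "a \<in> A" "b \<in> B" for a b
      using P(1) that by (simp add: \<pi>_def transport_plan_def)
    moreover have "\<pi> (u, v) = 0" if "u \<notin> A \<or> v \<notin> B" for u v
      using that by (auto simp: \<pi>_def)
    ultimately show ?thesis using cost[of \<pi>] by simp
  qed
  ultimately show ?thesis
    unfolding wasserstein_def using lower by (intro antisym INF_greatest) (auto intro: INF_lower2)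
qed

section \<open>Curvature of an edge as a transport problem\<close>

text \<open>One index set for all idlenesses: every \<open>lazy_measure G p x\<close> vanishes
  outside it, and for \<open>p = 0\<close> or \<open>p = 1\<close> weights inside it may be 0
  too.\<close>

definition closed_ball :: "'a sgraph \<Rightarrow> 'a \<Rightarrow> 'a set"
  where "closed_ball G x = insert x {z. adj G x z}"

context locally_finite_graph
begin

lemma closed_ball_basic:
  assumes "x \<in> vertices G"
  shows "finite (closed_ball G x)" and "closed_ball G x \<subseteq> vertices G" and "x \<in> closed_ball G x"
  using assms locally_finite adj_vertices by (auto simp: closed_ball_def)

lemma closed_ball_walk:
  assumes "a \<in> closed_ball G x"
  shows "\<exists>n. (adj G ^^ n) x a \<and> (adj G ^^ n) a x \<and> n \<le> 1"
proof (cases "a = x")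
  case True
  then have "(adj G ^^ 0) x a \<and> (adj G ^^ 0) a x" by simp
  then show ?thesis by blast
next
  case False
  then have "adj G x a" "adj G a x" using assms adj_sym by (auto simp: closed_ball_def)
  then have "(adj G ^^ 1) x a \<and> (adj G ^^ 1) a x" by (simp only: relpowp_1)
  then show ?thesis by blast
qed

lemma closed_balls_walk:
  assumes "adj G x y" and "a \<in> closed_ball G x" and "b \<in> closed_ball G y"
  shows "\<exists>n. (adj G ^^ n) a b \<and> n \<le> 3"
proof -
  obtain k l where "(adj G ^^ k) a x" "k \<le> 1" "(adj G ^^ l) y b" "l \<le> 1"
    using closed_ball_walk assms(2,3) by metis
  moreover have "(adj G ^^ 1) x y" using assms(1) by (simp only: relpowp_1)
  ultimately have "(adj G ^^ (k + 1 + l)) a b" by (meson relpowp_trans)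
  then show ?thesis using \<open>k \<le> 1\<close> \<open>l \<le> 1\<close> by (intro exI[of _ "k + 1 + l"]) simp
qed

lemma curvature_at_eq:
  assumes "adj G x y" and "vertex_degree G x = d" and "vertex_degree G y = d" and "p \<in> {0..1}"
    and "optimal_cost (graph_distance G) (closed_ball G x) (closed_ball G y)
      (\<lambda>a. if a = x then p else (1 - p) / real d) (\<lambda>b. if b = y then p else (1 - p) / real d) w"
  shows "curvature_at G p x y = 1 - w"
proof -
  let ?A = "closed_ball G x" and ?B = "closed_ball G y"
  have V: "x \<in> vertices G" "y \<in> vertices G" using adj_vertices assms(1) by blast+
  have q: "(1 - p) / real d \<le> 1"
    using assms(4) by (cases "d = 0") (auto simp: divide_le_eq)
  have "optimal_cost (graph_distance G) ?A ?B (lazy_measure G p x) (lazy_measure G p y) w"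
    by (rule optimal_cost_cong[OF assms(5)]) (auto simp: lazy_measure_def closed_ball_def assms(2,3))
  then have "wasserstein G (lazy_measure G p x) (lazy_measure G p y) = ennreal w"
  proof (rule wasserstein_eq[rotated -1])
    show "\<exists>n. (adj G ^^ n) a b" if "a \<in> ?A" "b \<in> ?B" for a b
      using closed_balls_walk[OF assms(1) that] by blast
  qed (use closed_ball_basic[OF V(1)] closed_ball_basic[OF V(2)] q assms(2-4)
      in \<open>auto simp: lazy_measure_def closed_ball_def\<close>)
  \<comment> \<open>\<open>ennreal\<close> truncates negative reals to 0, so \<open>w\<close> is
    recovered from \<open>ennreal w\<close> only if it is nonnegative.\<close>
  moreover have "0 \<le> w"
  proof -
    obtain P where "transport_plan ?A ?B (\<lambda>a. if a = x then p else (1 - p) / real d)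
        (\<lambda>b. if b = y then p else (1 - p) / real d) P"
      "transport_cost (graph_distance G) ?A ?B P = w"
      using assms(5) by (auto simp: optimal_cost_def)
    then show ?thesis
      by (auto simp: transport_cost_def transport_plan_def graph_distance_nonneg intro!: sum_nonneg)
  qed
  ultimately show ?thesis by (simp add: curvature_at_def)
qed

text \<open>The constants are obtained before \<open>p\<close> and \<open>q\<close>, so one pair
  governs all idlenesses and also the weights \<open>q\<close> that occur in the product.\<close>

lemma edge_optimal_cost:
  assumes xy: "adj G x y" and deg: "vertex_degree G x = vertex_degree G y"
  obtains m0 m1 where "\<And>p q. \<lbrakk>0 \<le> p; 0 \<le> q\<rbrakk> \<Longrightarrow>
    optimal_cost (graph_distance G) (closed_ball G x) (closed_ball G y)
      (\<lambda>a. if a = x then p else q) (\<lambda>b. if b = y then p else q)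
      (if p \<le> q then (q - p) * m0 + p * m1 else q * m1 + (p - q))"
proof -
  let ?d = "graph_distance G"
  have V: "x \<in> vertices G" "y \<in> vertices G" using adj_vertices xy by blast+
  have ne: "x \<noteq> y" using xy adj_irrefl by blast
  show thesis
  proof (rule star_optimal_cost[where N = "{z. adj G x z}" and N' = "{z. adj G y z}" and x = x and y = y
        and c = ?d and A = "closed_ball G x" and B = "closed_ball G y"])
    show "finite {z. adj G x z}" "finite {z. adj G y z}" using V locally_finite by auto
    show "?d x y = 1" using graph_distance_adj xy ne .
    fix a b assume ab: "a \<in> closed_ball G x - closed_ball G y" "b \<in> closed_ball G y - closed_ball G x"
    obtain n where n: "(adj G ^^ n) a b" "n \<le> 3" using closed_balls_walk[OF xy] ab by blast
    obtain k where k: "(adj G ^^ k) a y" using closed_balls_walk[OF xy, of a y] ab closed_ball_basic V by blast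
    obtain l where l: "(adj G ^^ l) x b" using closed_balls_walk[OF xy, of x b] ab closed_ball_basic V by blast
    have "?d a b \<le> 3" using graph_distance_le[OF n(1)] n(2) by simp
    moreover have "2 \<le> ?d a y"
      using graph_distance_ge_2[OF k] ab adj_sym by (auto simp: closed_ball_def)
    moreover have "2 \<le> ?d x b"
      using graph_distance_ge_2[OF l] ab by (auto simp: closed_ball_def)
    ultimately show "?d a b \<le> 3 \<and> 2 \<le> ?d a y \<and> 2 \<le> ?d x b" by simp
  next
    fix a z b
    assume ab: "a \<in> closed_ball G x" "z \<in> closed_ball G x \<inter> closed_ball G y" "b \<in> closed_ball G y"
    then obtain k l where "(adj G ^^ k) a z" "(adj G ^^ l) z b"
      using closed_balls_walk[OF xy] by (metis IntD1 IntD2)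
    then show "?d a b \<le> ?d a z + ?d z b" by (rule graph_distance_triangle)
  next
    fix m0 m1
    assume *: "\<And>p q. \<lbrakk>0 \<le> p; 0 \<le> q\<rbrakk> \<Longrightarrow> optimal_cost ?d (closed_ball G x) (closed_ball G y)
      (\<lambda>a. if a = x then p else q) (\<lambda>b. if b = y then p else q)
      (if p \<le> q then (q - p) * m0 + p * m1 else q * m1 + (p - q))"
    show thesis by (rule that) (rule *)
  qed (use xy deg ne adj_sym adj_irrefl in
      \<open>auto simp: closed_ball_def vertex_degree_def graph_distance_refl\<close>)
qed

end

section \<open>Edges of a Cartesian product\<close>

lemma closed_ball_cartesian_product:
  assumes "x \<in> vertices G" and "v \<in> vertices H"
  shows "closed_ball (cartesian_product G H) (x, v) = closed_ball G x \<times> {v} \<union> {x} \<times> {w. adj H v w}"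
  using assms by (auto simp: closed_ball_def cartesian_product_def)

lemma vertex_degree_cartesian_product:
  assumes "locally_finite_graph G" and "locally_finite_graph H"
    and "x \<in> vertices G" and "v \<in> vertices H"
  shows "vertex_degree (cartesian_product G H) (x, v) = vertex_degree G x + vertex_degree H v"
proof -
  interpret G: locally_finite_graph G by fact
  interpret H: locally_finite_graph H by fact
  have "{s. adj (cartesian_product G H) (x, v) s} = {a. adj G x a} \<times> {v} \<union> {x} \<times> {w. adj H v w}"
    using assms(3,4) by (auto simp: cartesian_product_def)
  moreover have "card ({a. adj G x a} \<times> {v} \<union> {x} \<times> {w. adj H v w})
      = card ({a. adj G x a} \<times> {v}) + card ({x} \<times> {w. adj H v w})"
    using assms(3,4) G.locally_finite H.locally_finite G.adj_irrefl
    by (intro card_Un_disjoint) auto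
  ultimately show ?thesis by (simp add: vertex_degree_def card_cartesian_product)
qed

text \<open>\<open>q\<close> stays free because the product divides \<open>1 - p\<close> by the sum
  of the two degrees. Distances of the factors add up, which is the cost in
  \<open>product_optimal_cost\<close>.\<close>

lemma cartesian_product_edge_optimal_cost:
  assumes G: "locally_finite_graph G" and H: "locally_finite_graph H"
    and xy: "adj G x y" and v: "v \<in> vertices H" and q: "0 \<le> q"
    and opt: "optimal_cost (graph_distance G) (closed_ball G x) (closed_ball G y)
      (\<lambda>a. if a = x then p else q) (\<lambda>b. if b = y then p else q) w"
  shows "optimal_cost (graph_distance (cartesian_product G H))
    (closed_ball (cartesian_product G H) (x, v)) (closed_ball (cartesian_product G H) (y, v))
    (\<lambda>r. if r = (x, v) then p else q) (\<lambda>s. if s = (y, v) then p else q)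
    (w + real (vertex_degree H v) * q)"
proof -
  interpret G: locally_finite_graph G by fact
  interpret H: locally_finite_graph H by fact
  let ?A = "closed_ball G x" and ?B = "closed_ball G y" and ?W = "{w. adj H v w}"
  let ?d = "graph_distance G" and ?h = "graph_distance H"
  have V: "x \<in> vertices G" "y \<in> vertices G" using G.adj_vertices xy by blast+
  have ne: "x \<noteq> y" using xy G.adj_irrefl by blast
  have walkG: "\<exists>n. (adj G ^^ n) a b" if "a \<in> ?A" "b \<in> ?B" for a b
    using G.closed_balls_walk[OF xy that] by blast
  have walkH: "\<exists>n. (adj H ^^ n) u w" if "u \<in> insert v ?W" "w \<in> insert v ?W" for u w
  proof -
    have "u \<in> closed_ball H v" "w \<in> closed_ball H v" using that by (simp_all add: closed_ball_def)
    then obtain k l where "(adj H ^^ k) u v" "(adj H ^^ l) v w"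
      using H.closed_ball_walk by metis
    then show ?thesis using relpowp_trans by metis
  qed
  have balls: "closed_ball (cartesian_product G H) (x, v) = ?A \<times> {v} \<union> {x} \<times> ?W"
    "closed_ball (cartesian_product G H) (y, v) = ?B \<times> {v} \<union> {y} \<times> ?W"
    using closed_ball_cartesian_product V v by metis+
  have xA: "x \<in> ?A" and yB: "y \<in> ?B" using G.closed_ball_basic V by auto
  have "optimal_cost (\<lambda>r s. ?d (fst r) (fst s) + ?h (snd r) (snd s))
    (?A \<times> {v} \<union> {x} \<times> ?W) (?B \<times> {v} \<union> {y} \<times> ?W)
    (\<lambda>r. if snd r = v then if fst r = x then p else q else q)
    (\<lambda>s. if snd s = v then if fst s = y then p else q else q)
    (w + real (card ?W) * q)"
  proof (rule product_optimal_cost[OF _ _ _ xA yB _ _ _ _ _ _ _ _ _ q opt])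
    show "finite ?A" "finite ?B" "finite ?W" using G.closed_ball_basic V H.locally_finite v by auto
    show "?d x y = 1" using graph_distance_adj xy ne .
    show "v \<notin> ?W" using H.adj_irrefl by simp
    show "?h v w = 1" "?h w v = 1" if "w \<in> ?W" for w
      using that H.adj_irrefl H.adj_sym by (auto intro!: graph_distance_adj)
    show "?h u w' \<le> ?h u w + ?h w w'" if uw: "u \<in> ?W" "w \<in> ?W" "w' \<in> ?W" for u w w'
    proof -
      obtain k l where "(adj H ^^ k) u w" "(adj H ^^ l) w w'"
        using walkH[of u w] walkH[of w w'] uw by blast
      then show ?thesis by (rule graph_distance_triangle)
    qed
    \<comment> \<open>The detour from \<open>a\<close> over \<open>y\<close> and \<open>x\<close> to
      \<open>b\<close>, along the edge in reverse.\<close>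
    fix a b assume a: "a \<in> ?A" and b: "b \<in> ?B"
    obtain i j where i: "(adj G ^^ i) a y" and j: "(adj G ^^ j) x b"
      using walkG a b xA yB by metis
    have yx: "adj G y x" using xy G.adj_sym by blast
    then have 1: "(adj G ^^ 1) y x" by (simp only: relpowp_1)
    have "?d a b \<le> ?d a y + ?d y b"
      using graph_distance_triangle[OF i relpowp_trans[OF 1 j]] .
    also have "?d y b \<le> ?d y x + ?d x b" by (rule graph_distance_triangle[OF 1 j])
    also have "?d y x = 1" using graph_distance_adj[OF yx] ne by simp
    finally show "?d a b \<le> ?d a y + 1 + ?d x b" by simp
  qed (simp_all add: graph_distance_refl graph_distance_nonneg)
  then show ?thesis
    unfolding balls
  proof (rule optimal_cost_cong)
    fix r s assume r: "r \<in> ?A \<times> {v} \<union> {x} \<times> ?W" and s: "s \<in> ?B \<times> {v} \<union> {y} \<times> ?W"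
    obtain a \<alpha> b \<beta> where rs: "r = (a, \<alpha>)" "s = (b, \<beta>)" by (metis surj_pair)
    have *: "a \<in> ?A" "b \<in> ?B" "\<alpha> \<in> insert v ?W" "\<beta> \<in> insert v ?W"
      using r s rs xA yB by auto
    then have "a \<in> vertices G" "\<alpha> \<in> vertices H"
      using G.closed_ball_basic V H.adj_vertices v by auto
    moreover obtain k l where "(adj G ^^ k) a b" "(adj H ^^ l) \<alpha> \<beta>"
      using walkG walkH * by metis
    ultimately have "graph_distance (cartesian_product G H) (a, \<alpha>) (b, \<beta>) = ?d a b + ?h \<alpha> \<beta>"
      by (rule graph_distance_cartesian_product[OF G])
    then show "?d (fst r) (fst s) + ?h (snd r) (snd s) = graph_distance (cartesian_product G H) r s"
      by (simp add: rs)
  qed (auto simp: vertex_degree_def)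
qed

section \<open>The two regimes of the idleness\<close>

theorem corollary1p3:
  fixes G :: "'a sgraph" and H :: "'b sgraph"
    and d\<^sub>G d\<^sub>H :: nat and x\<^sub>1 x\<^sub>2 :: 'a and y :: 'b and p :: real
  assumes "locally_finite_graph G" and "regular_graph G d\<^sub>G"
    and "locally_finite_graph H" and "regular_graph H d\<^sub>H"
    and "adj G x\<^sub>1 x\<^sub>2" and "y \<in> vertices H"
  shows "(p \<in> {0..1 / (real d\<^sub>G + real d\<^sub>H + 1)} \<longrightarrow>
      curvature_at (cartesian_product G H) p (x\<^sub>1, y) (x\<^sub>2, y) =
        real d\<^sub>G / (real d\<^sub>G + real d\<^sub>H) * curvature_at G p x\<^sub>1 x\<^sub>2
        + real d\<^sub>G * real d\<^sub>H / (real d\<^sub>G + real d\<^sub>H)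
          * (curvature G x\<^sub>1 x\<^sub>2 - curvature_at G 0 x\<^sub>1 x\<^sub>2) * p) \<and>
    (p \<in> {1 / (real d\<^sub>G + real d\<^sub>H + 1)..1} \<longrightarrow>
      curvature_at (cartesian_product G H) p (x\<^sub>1, y) (x\<^sub>2, y) =
        real d\<^sub>G / (real d\<^sub>G + real d\<^sub>H) * curvature G x\<^sub>1 x\<^sub>2 * (1 - p))"
proof -
  let ?GH = "cartesian_product G H"
  interpret G: locally_finite_graph G by fact
  interpret GH: locally_finite_graph ?GH
    using assms(1,3) by (rule locally_finite_graph_cartesian_product)
  define d e where "d = real d\<^sub>G" and "e = real d\<^sub>H"
  have V: "x\<^sub>1 \<in> vertices G" "x\<^sub>2 \<in> vertices G" using G.adj_vertices assms(5) by blast+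
  have deg: "vertex_degree G x\<^sub>1 = d\<^sub>G" "vertex_degree G x\<^sub>2 = d\<^sub>G" "vertex_degree H y = d\<^sub>H"
    using assms(2,4,6) V by (simp_all add: regular_graph_def)
  have degGH: "vertex_degree ?GH (x\<^sub>1, y) = d\<^sub>G + d\<^sub>H" "vertex_degree ?GH (x\<^sub>2, y) = d\<^sub>G + d\<^sub>H"
    using vertex_degree_cartesian_product[OF assms(1,3) _ assms(6)] V deg by simp_all
  have adjGH: "adj ?GH (x\<^sub>1, y) (x\<^sub>2, y)" using assms(5,6) by (simp add: cartesian_product_def)
  have "x\<^sub>2 \<in> {z. adj G x\<^sub>1 z}" using assms(5) by simp
  then have "0 < vertex_degree G x\<^sub>1"
    using G.locally_finite[OF V(1)] unfolding vertex_degree_def by (metis card_gt_0_iff empty_iff)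
  then have d: "1 \<le> d" and e: "0 \<le> e" using deg by (simp_all add: d_def e_def)
  obtain m0 m1 where opt: "\<And>p q. \<lbrakk>0 \<le> p; 0 \<le> q\<rbrakk> \<Longrightarrow>
    optimal_cost (graph_distance G) (closed_ball G x\<^sub>1) (closed_ball G x\<^sub>2)
      (\<lambda>a. if a = x\<^sub>1 then p else q) (\<lambda>b. if b = x\<^sub>2 then p else q)
      (if p \<le> q then (q - p) * m0 + p * m1 else q * m1 + (p - q))"
    using G.edge_optimal_cost[OF assms(5)] deg by metis
  define w where "w t s = (if t \<le> s then (s - t) * m0 + t * m1 else s * m1 + (t - s))" for t s :: real
  note opt = opt[folded w_def]
  have curvG: "curvature_at G t x\<^sub>1 x\<^sub>2 = 1 - w t ((1 - t) / d)" if "t \<in> {0..1}" for t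
    unfolding d_def
    by (rule G.curvature_at_eq[OF assms(5) deg(1,2) that], rule opt) (use that in auto)
  \<comment> \<open>The same \<open>w\<close> as in \<open>G\<close>, now at the smaller weight; the
    additional neighbours contribute \<open>e\<close> times that weight.\<close>
  have curvGH: "curvature_at ?GH t (x\<^sub>1, y) (x\<^sub>2, y)
      = 1 - (w t ((1 - t) / (d + e)) + e * ((1 - t) / (d + e)))" if t: "t \<in> {0..1}" for t
  proof (rule GH.curvature_at_eq[OF adjGH degGH t])
    have q: "0 \<le> (1 - t) / (d + e)" using t d e by simp
    have t0: "0 \<le> t" using t by simp
    have D: "real (d\<^sub>G + d\<^sub>H) = d + e" by (simp add: d_def e_def)
    have degH: "real (vertex_degree H y) = e" using deg(3) by (simp add: e_def)
    show "optimal_cost (graph_distance ?GH) (closed_ball ?GH (x\<^sub>1, y)) (closed_ball ?GH (x\<^sub>2, y))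
      (\<lambda>r. if r = (x\<^sub>1, y) then t else (1 - t) / real (d\<^sub>G + d\<^sub>H))
      (\<lambda>s. if s = (x\<^sub>2, y) then t else (1 - t) / real (d\<^sub>G + d\<^sub>H))
      (w t ((1 - t) / (d + e)) + e * ((1 - t) / (d + e)))"
      unfolding D
      by (rule cartesian_product_edge_optimal_cost[OF assms(1,3,5,6) q opt[OF t0 q], unfolded degH])
  qed
  have threshold: "t \<le> (1 - t) / D \<longleftrightarrow> t \<le> 1 / (D + 1)" if "1 \<le> D" for t D :: real
    using that by (simp add: field_simps)
  \<comment> \<open>Both branches of \<open>w\<close> agree at \<open>t = s\<close>, so the
    threshold itself belongs to both regimes.\<close>
  have w_high: "w t s = s * m1 + (t - s)" if "s \<le> t" for s t
    using that by (cases "s = t") (auto simp: w_def)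
  have curv: "curvature G x\<^sub>1 x\<^sub>2 = (d + 1 - m1) / d"
    unfolding curvature_def
  proof (rule tendsto_Lim)
    \<comment> \<open>Above the threshold the curvature is a fixed multiple of \<open>1 - t\<close>,
      so the quotient is constant near 1 and equals its limit.\<close>
    have "curvature_at G t x\<^sub>1 x\<^sub>2 / (1 - t) = (d + 1 - m1) / d" if t: "1 / (d + 1) < t" "t < 1" for t
    proof -
      have "0 < 1 / (d + 1)" using d by simp
      then have "0 < t" using t(1) by (rule less_trans)
      then have "t \<in> {0..1}" using t by simp
      moreover have "(1 - t) / d \<le> t" using threshold[OF d, of t] t by linarith
      ultimately have "curvature_at G t x\<^sub>1 x\<^sub>2 = 1 - ((1 - t) / d * m1 + (t - (1 - t) / d))"
        using curvG w_high by simp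
      also have "\<dots> = (1 - t) * ((d + 1 - m1) / d)" using d by (simp add: field_simps)
      finally show ?thesis using t by simp
    qed
    moreover have "\<forall>\<^sub>F t in at_left 1. t \<in> {1 / (d + 1)<..<1}"
      using d by (intro eventually_at_left_real) simp
    ultimately have "\<forall>\<^sub>F t in at_left 1. curvature_at G t x\<^sub>1 x\<^sub>2 / (1 - t) = (d + 1 - m1) / d"
      by (auto elim: eventually_mono)
    then show "((\<lambda>t. curvature_at G t x\<^sub>1 x\<^sub>2 / (1 - t)) \<longlongrightarrow> (d + 1 - m1) / d) (at_left 1)"
      by (rule tendsto_eventually)
  \<comment> \<open>What remains is that \<open>at_left 1\<close> is not the trivial filter.\<close>
  qed simp
  \<comment> \<open>Idleness 0 isolates \<open>m0\<close>. Hence the difference of the two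
    curvatures in the claim is \<open>(m0 + 1 - m1) / d\<close>.\<close>
  have curv0: "curvature_at G 0 x\<^sub>1 x\<^sub>2 = 1 - m0 / d"
    using d by (simp add: curvG w_def)
  have de: "1 \<le> d + e" using d e by simp
  show ?thesis
    unfolding d_def[symmetric] e_def[symmetric]
  proof (intro conjI impI)
    assume p: "p \<in> {0..1 / (d + e + 1)}"
    \<comment> \<open>The threshold of the product is at most that of \<open>G\<close>, so both
      costs are in the branch of small idleness.\<close>
    have "1 / (d + e + 1) \<le> 1 / (d + 1)" "1 / (d + 1) \<le> 1"
      using d e by (auto intro!: divide_left_mono)
    then have p1: "p \<in> {0..1}" and pd: "p \<le> 1 / (d + 1)" using p by auto
    have "curvature_at ?GH p (x\<^sub>1, y) (x\<^sub>2, y)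
        = 1 - (((1 - p) / (d + e) - p) * m0 + p * m1 + e * ((1 - p) / (d + e)))"
      using p threshold[OF de, of p] by (simp add: curvGH[OF p1] w_def)
    moreover have "curvature_at G p x\<^sub>1 x\<^sub>2 = 1 - (((1 - p) / d - p) * m0 + p * m1)"
      using pd threshold[OF d, of p] by (simp add: curvG[OF p1] w_def)
    ultimately show "curvature_at ?GH p (x\<^sub>1, y) (x\<^sub>2, y) = d / (d + e) * curvature_at G p x\<^sub>1 x\<^sub>2
        + d * e / (d + e) * (curvature G x\<^sub>1 x\<^sub>2 - curvature_at G 0 x\<^sub>1 x\<^sub>2) * p"
      unfolding curv curv0 using d de by (simp add: divide_simps) (simp add: algebra_simps)
  next
    assume p: "p \<in> {1 / (d + e + 1)..1}"
    have "0 \<le> 1 / (d + e + 1)" "1 / (d + e + 1) \<le> p" using de p by simp_all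
    then have "0 \<le> p" by (rule order_trans)
    then have p1: "p \<in> {0..1}" using p by simp
    have "(1 - p) / (d + e) \<le> p" using p de by (simp add: field_simps)
    then have "curvature_at ?GH p (x\<^sub>1, y) (x\<^sub>2, y)
        = 1 - ((1 - p) / (d + e) * m1 + (p - (1 - p) / (d + e)) + e * ((1 - p) / (d + e)))"
      by (simp add: curvGH[OF p1] w_high)
    then show "curvature_at ?GH p (x\<^sub>1, y) (x\<^sub>2, y) = d / (d + e) * curvature G x\<^sub>1 x\<^sub>2 * (1 - p)"
      unfolding curv using d de by (simp add: divide_simps) (simp add: algebra_simps)
  qed
qed

end
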